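(* Let $g=0$, and let $U=\{U_j^m\}_{0\le j\le J,\ m\ge 0}$ be a solution of the finite-difference scheme $$C_\theta[\rho_h]\bar\partial_t U^m+\mathcal A_h U^{(\sigma)\,m}=F^m\ \text{ on }\omega_h,\ m\ge 1;\qquad U_0^m=0,\ m\ge 1;\qquad U^0=U^0_h\ \text{ on }\bar\omega_h,$$ $$b_\infty\bar\partial_xU_J^{(\sigma)\,m}+h_J\,s_\theta^-\bigl(\rho_\infty\bar\partial_tU+c_\infty U^{(\sigma)}\bigr)^m_J=b_\infty\mathcal S^m\mathbf U_J^m+G^m,\quad m\ge 1,$$ where $G=\{G^m\}_{m\ge0}$ is given, $\mathbf U^m_J=\{U_J^0,\dots,U_J^m\}$, and for each $m\ge 1$, $\mathcal S^m$ is a linear operator taking a real sequence $\{\Phi^0,\dots,\Phi^m\}$ to a real number. Suppose that $$\sum_{m=1}^M(\mathcal S^m\boldsymbol\Phi^m)\,\bar\partial_t\Phi^{m}\,\tau_m\le 0\quad\text{for any } M\ge 1$$ for every real function $\Phi$ on $\{t_m\}_{m\ge 0}$ with $\Phi^0=0$ (where $\boldsymbol\Phi^m=\{\Phi^1,\dots,\Phi^m\}$, with $\Phi^0=0$). Then, for $\sigma\ge\frac12$ and $\theta<\frac14$, the bound $$\max\Bigl\{\max_{0\le m\le M}\|U^m\|_{\mathcal L_{\omega_{h\theta}}},\ \sqrt2\,\|U\|_{(2)}\Bigr\}\le\|U_h^0\|_{\mathcal L_{\omega_{h\theta}}}+\sqrt{\frac{2}{c_\theta\underline\rho}}\,\|F^{(0)}\|_{\omega_M^{h,\tau}}$$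 $$+\frac{4}{\sqrt\nu}\Bigl[\|F^{(1)\,0}\|_{\widetilde\omega_h}+\sum_{m=1}^M\|\bar\partial_tF^{(1)\,m}\|_{\widetilde\omega_h}\tau_m+\sqrt X\Bigl(|G^0|+\sum_{m=1}^M|\bar\partial_tG^m|\tau_m\Bigr)\Bigr]$$ holds for any $M\ge 1$ and any decomposition $F=F^{(0)}+\widehat\partial_xF^{(1)}$ with $F^{(1)}|_{j=J}=0$, where $c_\theta=1-4\max\{\theta,0\}$ and $$\|U\|_{(2)}^2=\sum_{m=1}^M\Bigl[(\sigma-\tfrac12)\tau_m\|\bar\partial_tU^m\|^2_{\mathcal L_{\omega_{h\theta}}}+\|\bar\partial_tU^m\|^2_{C_\theta[\rho_h]}\Bigr]\tau_m .$$ The bound holds also for $\theta=\frac14$ provided that $F^{(0)}=0$ (the summand with $F^{(0)}$ being dropped). Consequently, for $\sigma\ge\frac12$ and $\theta\le\frac14$, the scheme has a unique solution.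
   Context: All mesh functions are real-valued; $\sigma,\theta$ are real parameters. Coefficients: $\rho,b,c$ are continuous with $\rho(x)\ge\underline\rho>0$, $b(x)\ge\nu>0$, $c(x)\ge 0$ for $x>0$, and for some $X_0>0$: $\rho(x)=\rho_\infty>0$, $b(x)=b_\infty>0$, $c(x)=c_\infty\ge0$ for $x\ge X_0$. Fix $X>X_0$. Meshes: nodes $0=x_0<x_1<\dots<x_J=X<\dots$ with steps $h_j=x_j-x_{j-1}$, $h_J\le X-X_0$, $h_j=h:=h_J$ for $j\ge J$; $x_{j-1/2}=\frac{x_{j-1}+x_j}2$, $h_{j+1/2}=\frac{h_j+h_{j+1}}2$; $\bar\omega_h=\{x_j\}_{j=0}^J$, $\omega_h=\{x_j\}_{j=1}^{J-1}$. In time: $0=t_0<t_1<\dots$, $t_m\to\infty$, $\tau_m=t_m-t_{m-1}$. $H_0(\bar\omega_h)$ is the space of functions on $\bar\omega_h$ vanishing at $x_0=0$. Mesh coefficients: $\rho_{hj}=\rho(x_{j-1/2})$, $b_{hj}=b(x_{j-1/2})$, $c_{hj}=c(x_{j-1/2})$. Data: $F^m$ is given on $\omega_h$ for $m\ge1$; $U_h^0$ is given on $\bar\omega_h$ with $U^0_{h0}=U^0_{hJ}=0$. In the decomposition (required for $m\ge1$), $F^{(0)\,m}$ is given on $\omega_h$ for $m\ge1$ and $F^{(1)\,m}$ on $\{x_j\}_{j=1}^J$ for $m\ge 0$, with $F^{(1)\,m}_J=0$ for all $m\ge 0$. The values $F^{(1)\,0}$ and $G^0$ do not enter the scheme and are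 arbitrary. Operators: $\bar\partial_xW_j=\frac{W_j-W_{j-1}}{h_j}$, $\widehat\partial_xW_j=\frac{W_{j+1}-W_j}{h_{j+1/2}}$, $\widehat s_xW_j=\frac{h_j}{2h_{j+1/2}}W_j+\frac{h_{j+1}}{2h_{j+1/2}}W_{j+1}$, $$C_\theta[\varkappa_h]W_j=\theta\tfrac{h_j}{h_{j+1/2}}\varkappa_{hj}W_{j-1}+(1-2\theta)(\widehat s_x\varkappa_{hj})W_j+\theta\tfrac{h_{j+1}}{h_{j+1/2}}\varkappa_{h,j+1}W_{j+1},$$ $s_\theta^-W_J=\theta W_{J-1}+(\frac12-\theta)W_J$, $\mathcal A_hW=-\widehat\partial_x(b_h\bar\partial_xW)+C_\theta[c_h]W$. In time: $\bar\partial_t\Phi^m=\frac{\Phi^m-\Phi^{m-1}}{\tau_m}$, $\Phi^{(\sigma)\,m}=\sigma\Phi^m+(1-\sigma)\Phi^{m-1}$. Norms: $(V,W)_{\omega_h}=\sum_{j=1}^{J-1}V_jW_jh_{j+1/2}$, $(V,W)_{\widetilde\omega_h}=\sum_{j=1}^JV_jW_jh_j$, with norms $\|\cdot\|_{\omega_h}$, $\|\cdot\|_{\widetilde\omega_h}$. For $\theta\le\frac14$ and $U,W\in H_0(\bar\omega_h)$: $(U,W)_{C_\theta[\rho_h]}=(C_\theta[\rho_h]U,W)_{\omega_h}+\rho_{hJ}(s_\theta^-U)_JW_Jh_J$, $\|W\|_{C_\theta[\rho_h]}=(W,W)_{C_\theta[\rho_h]}^{1/2}$; $$\mathcal L_{\omega_{h\theta}}(U,W)=(b_h\bar\partial_xU,\bar\partial_xW)_{\widetilde\omega_h}+(C_\theta[c_h]U,W)_{\omega_h}+c_\infty(s_\theta^-U_J)W_Jh_J,\qquad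 \|W\|_{\mathcal L_{\omega_{h\theta}}}=\mathcal L_{\omega_{h\theta}}^{1/2}(W,W).$$ $\|V\|_{\omega_M^{h,\tau}}=(\sum_{m=1}^M\|V^m\|_{\omega_h}^2\tau_m)^{1/2}$. *)

theory Defs
  imports "HOL-Analysis.Analysis"
begin

text \<open>
  A function on the space mesh is a map \<open>nat \<Rightarrow> real\<close>, \<open>W j\<close> being its value at the node \<open>x j\<close>.
  A function of time is indexed by the time level, and \<open>U m j\<close> is the value of \<open>U\<close> at
  \<open>(x j, t m)\<close>.  Values at indices outside the mesh on which a function is given are irrelevant:
  no formula below refers to them.  The backward objects with index \<open>j - 1\<close> or \<open>m - 1\<close> are
  only used for indices \<open>\<ge> 1\<close>.
\<close>

text \<open>Used for both meshes: \<open>step x j\<close> is $h_j$ and \<open>step t m\<close> is $\tau_m$.\<close>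

definition step :: "(nat \<Rightarrow> real) \<Rightarrow> nat \<Rightarrow> real" where
  "step x j = x j - x (j - 1)"

text \<open>\<open>mid x j\<close> is $x_{j-1/2}$, and \<open>hstep x j\<close> is $h_{j+1/2}$.\<close>

definition mid :: "(nat \<Rightarrow> real) \<Rightarrow> nat \<Rightarrow> real" where
  "mid x j = (x (j - 1) + x j) / 2"

definition hstep :: "(nat \<Rightarrow> real) \<Rightarrow> nat \<Rightarrow> real" where
  "hstep x j = (step x j + step x (j + 1)) / 2"

definition mesh_coeff :: "(nat \<Rightarrow> real) \<Rightarrow> (real \<Rightarrow> real) \<Rightarrow> nat \<Rightarrow> real" where
  "mesh_coeff x k j = k (mid x j)"

definition dx_bar :: "(nat \<Rightarrow> real) \<Rightarrow> (nat \<Rightarrow> real) \<Rightarrow> nat \<Rightarrow> real" where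
  "dx_bar x W j = (W j - W (j - 1)) / step x j"

definition dx_hat :: "(nat \<Rightarrow> real) \<Rightarrow> (nat \<Rightarrow> real) \<Rightarrow> nat \<Rightarrow> real" where
  "dx_hat x W j = (W (j + 1) - W j) / hstep x j"

definition sx_hat :: "(nat \<Rightarrow> real) \<Rightarrow> (nat \<Rightarrow> real) \<Rightarrow> nat \<Rightarrow> real" where
  "sx_hat x W j = step x j / (2 * hstep x j) * W j + step x (j + 1) / (2 * hstep x j) * W (j + 1)"

definition C_op :: "real \<Rightarrow> (nat \<Rightarrow> real) \<Rightarrow> (nat \<Rightarrow> real) \<Rightarrow> (nat \<Rightarrow> real) \<Rightarrow> nat \<Rightarrow> real" where
  "C_op \<theta> x kh W j =
     \<theta> * (step x j / hstep x j) * kh j * W (j - 1)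
   + (1 - 2 * \<theta>) * sx_hat x kh j * W j
   + \<theta> * (step x (j + 1) / hstep x j) * kh (j + 1) * W (j + 1)"

definition s_minus :: "real \<Rightarrow> (nat \<Rightarrow> real) \<Rightarrow> nat \<Rightarrow> real" where
  "s_minus \<theta> W j = \<theta> * W (j - 1) + (1/2 - \<theta>) * W j"

definition A_op :: "real \<Rightarrow> (nat \<Rightarrow> real) \<Rightarrow> (nat \<Rightarrow> real) \<Rightarrow> (nat \<Rightarrow> real) \<Rightarrow> (nat \<Rightarrow> real) \<Rightarrow> nat \<Rightarrow> real" where
  "A_op \<theta> x bh ch W j = - dx_hat x (\<lambda>i. bh i * dx_bar x W i) j + C_op \<theta> x ch W j"

definition dt_bar :: "(nat \<Rightarrow> real) \<Rightarrow> (nat \<Rightarrow> real) \<Rightarrow> nat \<Rightarrow> real" where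
  "dt_bar t \<Phi> m = (\<Phi> m - \<Phi> (m - 1)) / step t m"

definition t_avg :: "real \<Rightarrow> (nat \<Rightarrow> real) \<Rightarrow> nat \<Rightarrow> real" where
  "t_avg \<sigma> \<Phi> m = \<sigma> * \<Phi> m + (1 - \<sigma>) * \<Phi> (m - 1)"

text \<open>The same operators in time, applied to functions of \<open>m\<close> and \<open>j\<close> at each fixed \<open>j\<close>.\<close>

definition Dt_bar :: "(nat \<Rightarrow> real) \<Rightarrow> (nat \<Rightarrow> nat \<Rightarrow> real) \<Rightarrow> nat \<Rightarrow> nat \<Rightarrow> real" where
  "Dt_bar t U m j = dt_bar t (\<lambda>k. U k j) m"

definition T_avg :: "real \<Rightarrow> (nat \<Rightarrow> nat \<Rightarrow> real) \<Rightarrow> nat \<Rightarrow> nat \<Rightarrow> real" where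
  "T_avg \<sigma> U m j = t_avg \<sigma> (\<lambda>k. U k j) m"

definition ip_omega :: "(nat \<Rightarrow> real) \<Rightarrow> nat \<Rightarrow> (nat \<Rightarrow> real) \<Rightarrow> (nat \<Rightarrow> real) \<Rightarrow> real" where
  "ip_omega x J V W = (\<Sum>j=1..J - 1. V j * W j * hstep x j)"

definition norm_omega :: "(nat \<Rightarrow> real) \<Rightarrow> nat \<Rightarrow> (nat \<Rightarrow> real) \<Rightarrow> real" where
  "norm_omega x J V = sqrt (ip_omega x J V V)"

definition ip_tilde :: "(nat \<Rightarrow> real) \<Rightarrow> nat \<Rightarrow> (nat \<Rightarrow> real) \<Rightarrow> (nat \<Rightarrow> real) \<Rightarrow> real" where
  "ip_tilde x J V W = (\<Sum>j=1..J. V j * W j * step x j)"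

definition norm_tilde :: "(nat \<Rightarrow> real) \<Rightarrow> nat \<Rightarrow> (nat \<Rightarrow> real) \<Rightarrow> real" where
  "norm_tilde x J V = sqrt (ip_tilde x J V V)"

definition ip_C :: "real \<Rightarrow> (nat \<Rightarrow> real) \<Rightarrow> nat \<Rightarrow> (nat \<Rightarrow> real) \<Rightarrow> (nat \<Rightarrow> real) \<Rightarrow> (nat \<Rightarrow> real) \<Rightarrow> real" where
  "ip_C \<theta> x J rh U W =
     ip_omega x J (C_op \<theta> x rh U) W + rh J * s_minus \<theta> U J * W J * step x J"

definition norm_C :: "real \<Rightarrow> (nat \<Rightarrow> real) \<Rightarrow> nat \<Rightarrow> (nat \<Rightarrow> real) \<Rightarrow> (nat \<Rightarrow> real) \<Rightarrow> real" where
  "norm_C \<theta> x J rh W = sqrt (ip_C \<theta> x J rh W W)"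

definition L_form ::
  "real \<Rightarrow> (nat \<Rightarrow> real) \<Rightarrow> nat \<Rightarrow> (nat \<Rightarrow> real) \<Rightarrow> (nat \<Rightarrow> real) \<Rightarrow> real \<Rightarrow> (nat \<Rightarrow> real) \<Rightarrow> (nat \<Rightarrow> real) \<Rightarrow> real" where
  "L_form \<theta> x J bh ch c_inf U W =
     ip_tilde x J (\<lambda>j. bh j * dx_bar x U j) (dx_bar x W)
   + ip_omega x J (C_op \<theta> x ch U) W
   + c_inf * s_minus \<theta> U J * W J * step x J"

definition norm_L ::
  "real \<Rightarrow> (nat \<Rightarrow> real) \<Rightarrow> nat \<Rightarrow> (nat \<Rightarrow> real) \<Rightarrow> (nat \<Rightarrow> real) \<Rightarrow> real \<Rightarrow> (nat \<Rightarrow> real) \<Rightarrow> real" where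
  "norm_L \<theta> x J bh ch c_inf W = sqrt (L_form \<theta> x J bh ch c_inf W W)"

definition norm_omega_time ::
  "(nat \<Rightarrow> real) \<Rightarrow> nat \<Rightarrow> (nat \<Rightarrow> real) \<Rightarrow> nat \<Rightarrow> (nat \<Rightarrow> nat \<Rightarrow> real) \<Rightarrow> real" where
  "norm_omega_time x J t M V = sqrt (\<Sum>m=1..M. (norm_omega x J (V m))\<^sup>2 * step t m)"

definition norm_two ::
  "real \<Rightarrow> real \<Rightarrow> (nat \<Rightarrow> real) \<Rightarrow> nat \<Rightarrow> (nat \<Rightarrow> real) \<Rightarrow> (nat \<Rightarrow> real) \<Rightarrow> (nat \<Rightarrow> real) \<Rightarrow> real
     \<Rightarrow> (nat \<Rightarrow> real) \<Rightarrow> nat \<Rightarrow> (nat \<Rightarrow> nat \<Rightarrow> real) \<Rightarrow> real" where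
  "norm_two \<sigma> \<theta> x J rh bh ch c_inf t M U = sqrt (\<Sum>m=1..M.
     ((\<sigma> - 1/2) * step t m * (norm_L \<theta> x J bh ch c_inf (Dt_bar t U m))\<^sup>2
      + (norm_C \<theta> x J rh (Dt_bar t U m))\<^sup>2) * step t m)"

text \<open>
  A linear operator taking \<open>{\<Phi> 0, \<dots>, \<Phi> m}\<close> to a real number, represented on whole sequences.
  The first clause says that it only reads the entries up to \<open>m\<close>.
\<close>

definition linear_upto :: "nat \<Rightarrow> ((nat \<Rightarrow> real) \<Rightarrow> real) \<Rightarrow> bool" where
  "linear_upto m T \<longleftrightarrow>
     (\<forall>\<Phi> \<Psi>. (\<forall>k\<le>m. \<Phi> k = \<Psi> k) \<longrightarrow> T \<Phi> = T \<Psi>) \<and>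
     (\<forall>\<Phi> \<Psi>. T (\<lambda>k. \<Phi> k + \<Psi> k) = T \<Phi> + T \<Psi>) \<and>
     (\<forall>a \<Phi>. T (\<lambda>k. a * \<Phi> k) = a * T \<Phi>)"

definition coefficients ::
  "(real \<Rightarrow> real) \<Rightarrow> (real \<Rightarrow> real) \<Rightarrow> (real \<Rightarrow> real) \<Rightarrow> real \<Rightarrow> real \<Rightarrow> real \<Rightarrow> real \<Rightarrow> real \<Rightarrow> real \<Rightarrow> bool" where
  "coefficients \<rho> b c \<rho>_low \<nu> \<rho>_inf b_inf c_inf X0 \<longleftrightarrow>
     continuous_on {0<..} \<rho> \<and> continuous_on {0<..} b \<and> continuous_on {0<..} c \<and>
     \<rho>_low > 0 \<and> \<nu> > 0 \<and> (\<forall>x>0. \<rho> x \<ge> \<rho>_low \<and> b x \<ge> \<nu> \<and> c x \<ge> 0) \<and>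
     \<rho>_inf > 0 \<and> b_inf > 0 \<and> c_inf \<ge> 0 \<and>
     X0 > 0 \<and> (\<forall>x\<ge>X0. \<rho> x = \<rho>_inf \<and> b x = b_inf \<and> c x = c_inf)"

definition space_mesh :: "(nat \<Rightarrow> real) \<Rightarrow> nat \<Rightarrow> real \<Rightarrow> real \<Rightarrow> bool" where
  "space_mesh x J X0 X \<longleftrightarrow>
     x 0 = 0 \<and> strict_mono x \<and> x J = X \<and> step x J \<le> X - X0 \<and> (\<forall>j\<ge>J. step x j = step x J)"

definition time_mesh :: "(nat \<Rightarrow> real) \<Rightarrow> bool" where
  "time_mesh t \<longleftrightarrow> t 0 = 0 \<and> strict_mono t \<and> filterlim t at_top sequentially"

definition scheme_solution ::
  "real \<Rightarrow> real \<Rightarrow> (nat \<Rightarrow> real) \<Rightarrow> nat \<Rightarrow> (nat \<Rightarrow> real) \<Rightarrow> (nat \<Rightarrow> real) \<Rightarrow> (nat \<Rightarrow> real)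
     \<Rightarrow> real \<Rightarrow> real \<Rightarrow> real \<Rightarrow> (nat \<Rightarrow> real) \<Rightarrow> (nat \<Rightarrow> (nat \<Rightarrow> real) \<Rightarrow> real)
     \<Rightarrow> (nat \<Rightarrow> nat \<Rightarrow> real) \<Rightarrow> (nat \<Rightarrow> real) \<Rightarrow> (nat \<Rightarrow> real) \<Rightarrow> (nat \<Rightarrow> nat \<Rightarrow> real) \<Rightarrow> bool" where
  "scheme_solution \<sigma> \<theta> x J rh bh ch \<rho>_inf b_inf c_inf t S F G Uh0 U \<longleftrightarrow>
     (\<forall>m\<ge>1. \<forall>j\<in>{1..J - 1}.
        C_op \<theta> x rh (Dt_bar t U m) j + A_op \<theta> x bh ch (T_avg \<sigma> U m) j = F m j) \<and>
     (\<forall>m\<ge>1. U m 0 = 0) \<and>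
     (\<forall>j\<le>J. U 0 j = Uh0 j) \<and>
     (\<forall>m\<ge>1.
        b_inf * dx_bar x (T_avg \<sigma> U m) J
        + step x J * s_minus \<theta> (\<lambda>j. \<rho>_inf * Dt_bar t U m j + c_inf * T_avg \<sigma> U m j) J
        = b_inf * S m (\<lambda>k. U k J) + G m)"

end

theory Submission
  imports Defs
begin

text \<open>
  The bound is the discrete energy estimate.  Pair the difference equations at the interior nodes
  (with weight $h_{j+1/2}$) and the boundary equation at $x_J$ (with weight one) with a mesh function
  \<open>W\<close> vanishing at $x_0$.  Summation by parts makes the two flux terms at $x_J$ cancel, and the
  half-cell term $h_J s_\theta^-$ of the boundary equation is exactly what completes the sums
  over \<open>\<omega>\<^sub>h\<close> to the symmetric forms of the two norms (\<open>weak_form\<close>).  Choose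
  \<open>W = \<partial>\<^sub>t U\<^sup>m\<close>, multiply by $2\tau_m$ and sum over time.  As $U^{(\sigma)}$ is the midpoint value
  plus $(\sigma-\frac12)\tau_m\bar\partial_tU$, the energy form telescopes up to a term that is
  nonnegative for $\sigma\ge\frac12$; the terms with \<open>S\<close> add up to something nonpositive,
  since the trace of \<open>U\<close> at $x_J$ starts from zero.  This is \<open>energy_inequality\<close>.

  The form with \<open>C\<^sub>\<theta>\<close> is a sum over cells of a quadratic form in the two nodal values, and this
  cell form is nonnegative for $\theta\le\frac14$ and bounds the nodal values for $\theta<\frac14$
  (\<open>element_mass_ge\<close>).  The latter absorbs $F^{(0)}$.  The data $F^{(1)}$ and \<open>G\<close> cannot be
  paired with \<open>\<partial>\<^sub>t U\<close> directly, which for $\sigma=\frac12$ is not controlled in the energy norm; they form a functional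
  that is bounded in the energy norm (\<open>flux_bound\<close>), and summation by parts in time moves the time
  difference from \<open>U\<close> onto them (\<open>flux_sum_bound\<close>).  If \<open>Y\<close> is the left-hand side of the bound
  and \<open>R\<close> the right-hand side, all this amounts to $Y^2\le RY$, hence $Y\le R$.

  A homogeneous scheme therefore has only the zero solution, which is uniqueness.  For existence,
  the linear system for one time level is definite with respect to the same pairing
  (\<open>residual_definite\<close>), a definite finite system is solvable (\<open>definite_system_solvable\<close>), and the
  levels are computed one after the other.
\<close>

section \<open>Finite linear systems and marching in time\<close>

text \<open>
  Gaussian elimination without pivoting, phrased for operators instead of matrices: the diagonal
  entry \<open>p\<close> of the unknown \<open>k\<close> to be eliminated is nonzero because the unit function at \<open>k\<close> is
  nonzero, and the Schur complement \<open>T'\<close> inherits definiteness because its pairing at \<open>w\<close> is the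
  pairing of \<open>T\<close> at the extension of \<open>w\<close> for which row \<open>k\<close> vanishes.
\<close>

lemma definite_system_solvable:
  fixes T :: "('a \<Rightarrow> real) \<Rightarrow> 'a \<Rightarrow> real"
  assumes "finite I"
    and "\<And>u v a i. T (\<lambda>j. u j + a * v j) i = T u i + a * T v i"
    and "\<And>w. \<forall>j. j \<notin> I \<longrightarrow> w j = 0 \<Longrightarrow> (\<Sum>i\<in>I. w i * T w i) = 0 \<Longrightarrow> \<forall>j. w j = 0"
  shows "\<exists>w. (\<forall>j. j \<notin> I \<longrightarrow> w j = 0) \<and> (\<forall>i\<in>I. T w i = f i)"
  using assms
proof (induction I arbitrary: T f rule: finite_induct)
  case empty
  show ?case by (intro exI[of _ "\<lambda>_. 0"]) simp
next
  case (insert k I)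
  note lin = insert.prems(1) and definite = insert.prems(2)
  define e :: "'a \<Rightarrow> real" where "e = (\<lambda>j. if j = k then 1 else 0)"
  define p where "p = T e k"
  have pair_e: "(\<Sum>i\<in>insert k I. e i * T e i) = p"
  proof -
    have "e i * T e i = 0" if "i \<in> I" for i
      using that insert.hyps by (auto simp: e_def)
    then have "(\<Sum>i\<in>I. e i * T e i) = 0" by (rule sum.neutral[rule_format])
    then show ?thesis using insert.hyps by (simp add: p_def e_def)
  qed
  have "p \<noteq> 0"
  proof
    assume "p = 0"
    then have "\<forall>j. e j = 0"
      using pair_e by (intro definite) (auto simp: e_def)
    then have "e k = 0" by blast
    then show False by (simp add: e_def)
  qed
  define T' where "T' = (\<lambda>w i. T w i - T w k / p * T e i)"
  have T'_alt: "T' w i = T (\<lambda>j. w j + (- (T w k / p)) * e j) i" for w i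
    unfolding T'_def lin by simp
  have "\<exists>w. (\<forall>j. j \<notin> I \<longrightarrow> w j = 0) \<and> (\<forall>i\<in>I. T' w i = f i - f k / p * T e i)"
  proof (rule insert.IH)
    show "T' (\<lambda>j. u j + a * v j) i = T' u i + a * T' v i" for u v a i
      unfolding T'_def lin by (simp add: add_divide_distrib algebra_simps)
  next
    fix w :: "'a \<Rightarrow> real"
    assume supp: "\<forall>j. j \<notin> I \<longrightarrow> w j = 0" and zero: "(\<Sum>i\<in>I. w i * T' w i) = 0"
    define v where "v = (\<lambda>j. w j + (- (T w k / p)) * e j)"
    have Tv: "T v i = T' w i" for i
      unfolding v_def T'_alt ..
    have "T v k = 0"
      using \<open>p \<noteq> 0\<close> unfolding Tv T'_def by (simp add: p_def)
    moreover have "v i = w i" if "i \<in> I" for i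
      using that insert.hyps by (auto simp: v_def e_def)
    ultimately have "(\<Sum>i\<in>insert k I. v i * T v i) = (\<Sum>i\<in>I. w i * T' w i)"
      using insert.hyps by (simp add: Tv)
    then have "\<forall>j. v j = 0"
      using zero supp by (intro definite) (auto simp: v_def e_def)
    moreover have "w j = v j" if "j \<in> I" for j
      using that insert.hyps by (auto simp: v_def e_def)
    ultimately show "\<forall>j. w j = 0"
      using supp by metis
  qed
  then obtain w where supp: "\<forall>j. j \<notin> I \<longrightarrow> w j = 0"
    and w: "\<And>i. i \<in> I \<Longrightarrow> T' w i = f i - f k / p * T e i"
    by blast
  define v where "v = (\<lambda>j. w j + ((f k - T w k) / p) * e j)"
  have Tv: "T v i = T w i + (f k - T w k) / p * T e i" for i
    unfolding v_def lin ..
  have "T v k = f k"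
    using \<open>p \<noteq> 0\<close> by (simp add: Tv p_def)
  moreover have "T v i = f i" if "i \<in> I" for i
    using w[OF that] by (simp add: Tv T'_def diff_divide_distrib algebra_simps)
  moreover have "v j = 0" if "j \<notin> insert k I" for j
    using that supp by (auto simp: v_def e_def)
  ultimately show ?case by blast
qed

text \<open>
  Step-by-step construction of a sequence: the condition on level \<open>m\<close> may read the whole history, as
  the operators \<open>S m\<close> do, so the recursion carries the history \<open>H n\<close> up to level \<open>n\<close>.
\<close>

lemma causal_recursion:
  fixes P :: "nat \<Rightarrow> (nat \<Rightarrow> 'a) \<Rightarrow> bool"
  assumes extend: "\<And>m V. m \<ge> 1 \<Longrightarrow> \<exists>w. P m (V(m := w))"
    and causal: "\<And>m U V. m \<ge> 1 \<Longrightarrow> \<forall>k\<le>m. U k = V k \<Longrightarrow> P m U = P m V"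
  shows "\<exists>U. U 0 = u0 \<and> (\<forall>m\<ge>1. P m U)"
proof -
  obtain w where w: "\<And>m V. m \<ge> 1 \<Longrightarrow> P m (V(m := w m V))"
    using extend by metis
  define H where "H = rec_nat (\<lambda>_. u0) (\<lambda>m V. V(Suc m := w (Suc m) V))"
  have H0: "H 0 = (\<lambda>_. u0)" and HS: "H (Suc m) = (H m)(Suc m := w (Suc m) (H m))" for m
    by (simp_all add: H_def)
  have hist: "k \<le> n \<Longrightarrow> H n k = H k k" for k n
    by (induction n) (auto simp: HS le_Suc_eq)
  have "P m (\<lambda>k. H k k)" if m: "m \<ge> 1" for m
  proof -
    obtain n where n: "m = Suc n" using m by (cases m) simp_all
    have "P m (H m)"
      using w[OF m, of "H n"] by (simp add: n HS)
    moreover have "P m (\<lambda>k. H k k) = P m (H m)"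
      using hist[of _ m] by (intro causal m) metis
    ultimately show ?thesis by simp
  qed
  then show ?thesis
    by (intro exI[of _ "\<lambda>k. H k k"]) (simp add: H0)
qed

section \<open>Summation by parts and the discrete forms\<close>

lemma step_pos: "strict_mono x \<Longrightarrow> 1 \<le> j \<Longrightarrow> 0 < step x j"
  by (simp add: step_def strict_mono_def)

lemma hstep_pos: "strict_mono x \<Longrightarrow> 1 \<le> j \<Longrightarrow> 0 < hstep x j"
  using step_pos[of x j] step_pos[of x "j + 1"] by (simp add: hstep_def)

lemma sum_increments:
  fixes f :: "nat \<Rightarrow> real"
  shows "(\<Sum>j=1..n. f j - f (j - 1)) = f n - f 0"
  by (induction n) auto

lemma sum_split_last:
  fixes f :: "nat \<Rightarrow> real"
  assumes "1 \<le> J"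
  shows "(\<Sum>j=1..J. f j) = (\<Sum>j=1..J - 1. f j) + f J"
  using assms by (cases J) auto

lemma summation_by_parts:
  fixes p W :: "nat \<Rightarrow> real"
  assumes "1 \<le> J" "W 0 = 0"
  shows "(\<Sum>j=1..J - 1. (p (j + 1) - p j) * W j) = p J * W J - (\<Sum>j=1..J. p j * (W j - W (j - 1)))"
proof -
  have "(\<Sum>j=1..n. (p (j + 1) - p j) * W j)
      = p (Suc n) * W (Suc n) - (\<Sum>j=1..Suc n. p j * (W j - W (j - 1)))" for n
    using assms(2) by (induction n) (simp_all add: algebra_simps)
  from this[of "J - 1"] show ?thesis
    using assms(1) by simp
qed

lemma weighted_Cauchy_Schwarz:
  fixes v w h :: "'a \<Rightarrow> real"
  assumes "\<And>j. j \<in> A \<Longrightarrow> 0 \<le> h j"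
  shows "\<bar>\<Sum>j\<in>A. v j * w j * h j\<bar> \<le> sqrt (\<Sum>j\<in>A. v j * v j * h j) * sqrt (\<Sum>j\<in>A. w j * w j * h j)"
proof -
  have "(\<Sum>j\<in>A. v j * w j * h j) = (\<Sum>j\<in>A. (v j * sqrt (h j)) * (w j * sqrt (h j)))"
    using assms by (intro sum.cong refl) (simp add: algebra_simps flip: real_sqrt_mult)
  moreover have "(\<Sum>j\<in>A. u j * u j * h j) = (\<Sum>j\<in>A. (u j * sqrt (h j))\<^sup>2)" for u :: "'a \<Rightarrow> real"
    using assms by (intro sum.cong refl) (simp add: power_mult_distrib power2_eq_square)
  ultimately have "(\<Sum>j\<in>A. v j * w j * h j)\<^sup>2
      \<le> (\<Sum>j\<in>A. v j * v j * h j) * (\<Sum>j\<in>A. w j * w j * h j)"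
    using Cauchy_Schwarz_ineq_sum[of "\<lambda>j. v j * sqrt (h j)" "\<lambda>j. w j * sqrt (h j)" A] by simp
  then show ?thesis
    using real_sqrt_le_mono by (fastforce simp: real_sqrt_mult)
qed

text \<open>
  Cell \<open>j\<close> contributes \<open>A j\<close> to the equation at its right end and \<open>B j\<close> to the equation at its left end.
  Collecting by cells instead of nodes shows that the form is symmetric, and reduces its sign to a
  quadratic form in two variables.  The boundary term with \<open>s_minus\<close> is the contribution of the last
  cell to its right end.
\<close>

lemma ip_C_elementwise:
  assumes "strict_mono x" "1 \<le> J" "W 0 = 0"
  shows "ip_C \<theta> x J k U W = (\<Sum>j=1..J. k j * step x j *
    (\<theta> * (U (j - 1) * W j + U j * W (j - 1)) + (1/2 - \<theta>) * (U j * W j + U (j - 1) * W (j - 1))))"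
proof -
  define A where "A = (\<lambda>j. k j * step x j * (\<theta> * U (j - 1) + (1/2 - \<theta>) * U j))"
  define B where "B = (\<lambda>j. k j * step x j * ((1/2 - \<theta>) * U (j - 1) + \<theta> * U j))"
  have C: "C_op \<theta> x k U j * hstep x j = A j + B (j + 1)" if "1 \<le> j" for j
    using hstep_pos[OF assms(1) that]
    by (simp add: C_op_def sx_hat_def A_def B_def field_simps)
  have regroup: "(\<Sum>j=1..n. (A j + B (j + 1)) * W j) + A (Suc n) * W (Suc n)
      = (\<Sum>j=1..Suc n. A j * W j + B j * W (j - 1))" for n
    using assms(3) by (induction n) (simp_all add: algebra_simps)
  have "ip_omega x J (C_op \<theta> x k U) W = (\<Sum>j=1..J - 1. (A j + B (j + 1)) * W j)"
    unfolding ip_omega_def 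
  proof (intro sum.cong refl)
    fix j assume "j \<in> {1..J - 1}"
    then have "(C_op \<theta> x k U j * hstep x j) * W j = (A j + B (j + 1)) * W j"
      by (simp add: C)
    then show "C_op \<theta> x k U j * W j * hstep x j = (A j + B (j + 1)) * W j"
      by (simp only: mult_ac)
  qed
  then have "ip_C \<theta> x J k U W = (\<Sum>j=1..J. A j * W j + B j * W (j - 1))"
    using regroup[of "J - 1"] assms(2) by (simp add: ip_C_def s_minus_def A_def mult_ac)
  also have "\<dots> = (\<Sum>j=1..J. k j * step x j *
    (\<theta> * (U (j - 1) * W j + U j * W (j - 1)) + (1/2 - \<theta>) * (U j * W j + U (j - 1) * W (j - 1))))"
    by (intro sum.cong refl) (simp add: A_def B_def algebra_simps)
  finally show ?thesis .
qed

lemma ip_C_linear_left: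
  "ip_C \<theta> x J k (\<lambda>j. u j + a * v j) W = ip_C \<theta> x J k u W + a * ip_C \<theta> x J k v W"
proof -
  have "C_op \<theta> x k (\<lambda>j. u j + a * v j) j = C_op \<theta> x k u j + a * C_op \<theta> x k v j" for j
    by (simp add: C_op_def add_divide_distrib algebra_simps)
  then show ?thesis
    by (simp add: ip_C_def ip_omega_def s_minus_def sum.distrib sum_distrib_left algebra_simps)
qed

lemma L_form_eq: "L_form \<theta> x J bh ch (ch J) U W
    = ip_tilde x J (\<lambda>j. bh j * dx_bar x U j) (dx_bar x W) + ip_C \<theta> x J ch U W"
  by (simp add: L_form_def ip_C_def)

lemma L_form_linear_left:
  "L_form \<theta> x J bh ch (ch J) (\<lambda>j. u j + a * v j) W
    = L_form \<theta> x J bh ch (ch J) u W + a * L_form \<theta> x J bh ch (ch J) v W"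
proof -
  have "bh j * dx_bar x (\<lambda>j. u j + a * v j) j * dx_bar x W j * step x j
     = bh j * dx_bar x u j * dx_bar x W j * step x j + a * (bh j * dx_bar x v j * dx_bar x W j * step x j)" for j
    by (simp add: dx_bar_def add_divide_distrib diff_divide_distrib algebra_simps)
  then have "ip_tilde x J (\<lambda>j. bh j * dx_bar x (\<lambda>j. u j + a * v j) j) (dx_bar x W)
     = ip_tilde x J (\<lambda>j. bh j * dx_bar x u j) (dx_bar x W)
       + a * ip_tilde x J (\<lambda>j. bh j * dx_bar x v j) (dx_bar x W)"
    by (simp add: ip_tilde_def sum.distrib sum_distrib_left)
  then show ?thesis
    by (simp add: L_form_eq ip_C_linear_left algebra_simps)
qed

lemma ip_C_commute:
  assumes "strict_mono x" "1 \<le> J" "U 0 = 0" "W 0 = 0"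
  shows "ip_C \<theta> x J k U W = ip_C \<theta> x J k W U"
  unfolding ip_C_elementwise[OF assms(1,2), where W = U, OF assms(3)] ip_C_elementwise[OF assms(1,2), where W = W, OF assms(4)]
  by (intro sum.cong refl) (simp add: algebra_simps)

lemma L_form_commute:
  assumes "strict_mono x" "1 \<le> J" "U 0 = 0" "W 0 = 0"
  shows "L_form \<theta> x J bh ch (ch J) U W = L_form \<theta> x J bh ch (ch J) W U"
  unfolding L_form_eq ip_C_commute[OF assms(1,2), where U = U and W = W, OF assms(3,4)] by (simp add: ip_tilde_def mult_ac)

lemma ip_C_cong:
  assumes "1 \<le> J" "\<And>j. j \<le> J \<Longrightarrow> U j = U' j" "\<And>j. j \<le> J \<Longrightarrow> W j = W' j"
  shows "ip_C \<theta> x J k U W = ip_C \<theta> x J k U' W'"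
  unfolding ip_C_def ip_omega_def using assms
  by (auto simp: s_minus_def C_op_def intro!: sum.cong)

lemma L_form_cong:
  assumes "1 \<le> J" "\<And>j. j \<le> J \<Longrightarrow> U j = U' j" "\<And>j. j \<le> J \<Longrightarrow> W j = W' j"
  shows "L_form \<theta> x J bh ch (ch J) U W = L_form \<theta> x J bh ch (ch J) U' W'"
proof -
  have "dx_bar x U j = dx_bar x U' j" "dx_bar x W j = dx_bar x W' j" if "j \<in> {1..J}" for j
    using that assms(2,3) le_trans[OF diff_le_self, of j J 1] by (simp_all add: dx_bar_def)
  then have "ip_tilde x J (\<lambda>j. bh j * dx_bar x U j) (dx_bar x W)
      = ip_tilde x J (\<lambda>j. bh j * dx_bar x U' j) (dx_bar x W')"
    unfolding ip_tilde_def by (intro sum.cong refl) simp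
  then show ?thesis
    unfolding L_form_eq using ip_C_cong[OF assms] by simp
qed

text \<open>
  The right-hand side is $\frac12(a^2+b^2)-\theta(a-b)^2$; for $\theta\ge0$ the subtracted term is
  largest relative to $a^2+b^2$ at $a=-b$, which gives the factor $1-4\theta$.
\<close>

lemma element_mass_ge:
  fixes a b \<theta> :: real
  assumes "\<theta> \<le> 1/4"
  shows "(1 - 4 * max \<theta> 0) / 2 * (a * a + b * b)
    \<le> \<theta> * (a * b + b * a) + (1/2 - \<theta>) * (b * b + a * a)"
proof (cases "\<theta> \<ge> 0")
  case True
  have "\<theta> * (a * b + b * a) + (1/2 - \<theta>) * (b * b + a * a) - (1 - 4 * \<theta>) / 2 * (a * a + b * b)
      = \<theta> * (a + b)\<^sup>2"
    by (simp add: power2_eq_square field_simps)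
  also have "\<dots> \<ge> 0" using True by simp
  finally show ?thesis
    using True by (simp add: max_def)
next
  case False
  have "\<theta> * (a * b + b * a) + (1/2 - \<theta>) * (b * b + a * a) - 1 / 2 * (a * a + b * b)
      = (- \<theta>) * (a - b)\<^sup>2"
    by (simp add: power2_eq_square field_simps)
  also have "\<dots> \<ge> 0" using False by (intro mult_nonneg_nonneg) auto
  finally show ?thesis
    using False by (simp add: max_def)
qed

lemma ip_C_nonneg:
  assumes "strict_mono x" "1 \<le> J" "\<theta> \<le> 1/4" "\<And>j. j \<in> {1..J} \<Longrightarrow> 0 \<le> k j" "W 0 = 0"
  shows "0 \<le> ip_C \<theta> x J k W W"
  unfolding ip_C_elementwise[OF assms(1,2), where W = W, OF assms(5)]
proof (intro sum_nonneg mult_nonneg_nonneg)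
  fix j assume j: "j \<in> {1..J}"
  show "0 \<le> k j" using assms(4) j .
  show "0 \<le> step x j" using step_pos[OF assms(1)] j by (simp add: less_imp_le)
  have "0 \<le> (1 - 4 * max \<theta> 0) / 2 * (W (j - 1) * W (j - 1) + W j * W j)"
    using assms(3) by (intro mult_nonneg_nonneg) auto
  also note element_mass_ge[OF assms(3)]
  finally show "0 \<le> \<theta> * (W (j - 1) * W j + W j * W (j - 1))
      + (1/2 - \<theta>) * (W j * W j + W (j - 1) * W (j - 1))" .
qed

lemma ip_C_coercive:
  assumes "strict_mono x" "1 \<le> J" "\<theta> \<le> 1/4" "0 \<le> r" "\<And>j. j \<in> {1..J} \<Longrightarrow> r \<le> k j" "W 0 = 0"
  shows "(1 - 4 * max \<theta> 0) * r * ip_omega x J W W \<le> ip_C \<theta> x J k W W"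
proof -
  define c where "c = (1 - 4 * max \<theta> 0) * r"
  have "0 \<le> c" using assms(3,4) by (simp add: c_def)
  (* the half-weighted squares at the two ends of each cell add up to hstep at an interior node;
     the half-cell at the right end point is dropped *)
  have omega: "ip_omega x J W W
      \<le> (\<Sum>j=1..J. step x j / 2 * (W (j - 1) * W (j - 1) + W j * W j))"
  proof -
    have "(\<Sum>j=1..n. W j * W j * hstep x j) + step x (Suc n) / 2 * (W (Suc n) * W (Suc n))
        = (\<Sum>j=1..Suc n. step x j / 2 * (W (j - 1) * W (j - 1) + W j * W j))" for n
      using assms(6) by (induction n) (simp_all add: hstep_def field_simps)
    from this[of "J - 1"] show ?thesis
      using assms(2) step_pos[OF assms(1,2)] unfolding ip_omega_def
      by (smt (verit, best) Suc_diff_1 less_eq_Suc_le One_nat_def divide_nonneg_nonneg mult_nonneg_nonneg zero_le_square)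
  qed
  have "c * ip_omega x J W W \<le> c * (\<Sum>j=1..J. step x j / 2 * (W (j - 1) * W (j - 1) + W j * W j))"
    using omega \<open>0 \<le> c\<close> by (rule mult_left_mono)
  also have "\<dots> = (\<Sum>j=1..J. c * (step x j / 2 * (W (j - 1) * W (j - 1) + W j * W j)))"
    by (simp add: sum_distrib_left)
  also have "\<dots> \<le> (\<Sum>j=1..J. k j * step x j * (\<theta> * (W (j - 1) * W j + W j * W (j - 1))
      + (1/2 - \<theta>) * (W j * W j + W (j - 1) * W (j - 1))))"
  proof (rule sum_mono)
    fix j assume j: "j \<in> {1..J}"
    let ?s = "W (j - 1) * W (j - 1) + W j * W j"
    have st: "0 \<le> step x j" using step_pos[OF assms(1)] j by (simp add: less_imp_le)
    have "c * (step x j / 2 * ?s) = r * step x j * ((1 - 4 * max \<theta> 0) / 2 * ?s)"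
      by (simp add: c_def)
    also have "\<dots> \<le> k j * step x j * ((1 - 4 * max \<theta> 0) / 2 * ?s)"
      using assms(3) assms(5)[OF j] st by (intro mult_right_mono mult_nonneg_nonneg) auto
    also have "\<dots> \<le> k j * step x j * (\<theta> * (W (j - 1) * W j + W j * W (j - 1))
      + (1/2 - \<theta>) * (W j * W j + W (j - 1) * W (j - 1)))"
      using assms(4) assms(5)[OF j] st
      by (intro mult_left_mono element_mass_ge assms(3) mult_nonneg_nonneg) auto
    finally show "c * (step x j / 2 * ?s) \<le> \<dots>" .
  qed
  also have "\<dots> = ip_C \<theta> x J k W W"
    by (rule ip_C_elementwise[OF assms(1,2), where W = W, OF assms(6), symmetric])
  finally show ?thesis by (simp add: c_def)
qed

section \<open>The implicit scheme in weak form\<close>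

text \<open>
  The values of the coefficients at infinity enter the scheme only as their values in the last cell,
  so they are represented by \<open>rh J\<close>, \<open>bh J\<close> and \<open>ch J\<close>.
\<close>

locale implicit_scheme =
  fixes x t :: "nat \<Rightarrow> real" and J :: nat and rh bh ch :: "nat \<Rightarrow> real"
    and \<sigma> \<theta> \<rho>_low \<nu> :: real and S :: "nat \<Rightarrow> (nat \<Rightarrow> real) \<Rightarrow> real"
  assumes x0: "x 0 = 0" and x_mono: "strict_mono x" and J_pos: "1 \<le> J"
    and t_mono: "strict_mono t"
    and rh_ge: "\<And>j. j \<in> {1..J} \<Longrightarrow> \<rho>_low \<le> rh j" and \<rho>_low_pos: "0 < \<rho>_low"
    and bh_ge: "\<And>j. j \<in> {1..J} \<Longrightarrow> \<nu> \<le> bh j" and \<nu>_pos: "0 < \<nu>"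
    and ch_ge: "\<And>j. j \<in> {1..J} \<Longrightarrow> 0 \<le> ch j"
    and \<theta>_le: "\<theta> \<le> 1/4" and \<sigma>_ge: "1/2 \<le> \<sigma>"
    and S_linear: "\<And>m. 1 \<le> m \<Longrightarrow> linear_upto m (S m)"
    and S_dissipative:
      "\<And>\<Phi> M. \<Phi> 0 = 0 \<Longrightarrow> 1 \<le> M \<Longrightarrow> (\<Sum>m=1..M. S m \<Phi> * dt_bar t \<Phi> m * step t m) \<le> 0"
begin

abbreviation "mass \<equiv> ip_C \<theta> x J rh"
abbreviation "energy \<equiv> L_form \<theta> x J bh ch (ch J)"
abbreviation "energy_norm \<equiv> norm_L \<theta> x J bh ch (ch J)"

text \<open>
  The equation at node \<open>j\<close>, with the boundary equation as the one at node \<open>J\<close>.  The interior equations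
  carry the weight \<open>hstep x j\<close> so that the weak form is the plain sum of products with \<open>W j\<close>.
\<close>

definition residual :: "(nat \<Rightarrow> nat \<Rightarrow> real) \<Rightarrow> nat \<Rightarrow> nat \<Rightarrow> real" where
  "residual U m j =
    (if j = J
     then bh J * dx_bar x (T_avg \<sigma> U m) J
        + step x J * s_minus \<theta> (\<lambda>i. rh J * Dt_bar t U m i + ch J * T_avg \<sigma> U m i) J
        - bh J * S m (\<lambda>k. U k J)
     else (C_op \<theta> x rh (Dt_bar t U m) j + A_op \<theta> x bh ch (T_avg \<sigma> U m) j) * hstep x j)"

definition load :: "(nat \<Rightarrow> nat \<Rightarrow> real) \<Rightarrow> (nat \<Rightarrow> real) \<Rightarrow> nat \<Rightarrow> nat \<Rightarrow> real" where
  "load F G m j = (if j = J then G m else F m j * hstep x j)"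

abbreviation "solution F G Uh0 \<equiv>
  scheme_solution \<sigma> \<theta> x J rh bh ch (rh J) (bh J) (ch J) t S F G Uh0"

lemma tau_pos: "1 \<le> m \<Longrightarrow> 0 < step t m"
  using step_pos[OF t_mono] .

lemma x_J_nonneg: "0 \<le> x J"
  using strict_mono_leD[OF x_mono, of 0 J] x0 by simp

lemma norm_tilde_nonneg: "0 \<le> norm_tilde x J f"
  unfolding norm_tilde_def ip_tilde_def using step_pos[OF x_mono]
  by (intro real_sqrt_ge_zero sum_nonneg mult_nonneg_nonneg[OF zero_le_square])
    (simp add: less_imp_le)

lemma norm_omega_time_nonneg: "0 \<le> norm_omega_time x J t M f"
  unfolding norm_omega_time_def using tau_pos
  by (intro real_sqrt_ge_zero sum_nonneg) (auto simp: less_imp_le)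

lemma solution_iff:
  "solution F G Uh0 U \<longleftrightarrow>
    (\<forall>m\<ge>1. U m 0 = 0 \<and> (\<forall>j\<in>{1..J}. residual U m j = load F G m j)) \<and> (\<forall>j\<le>J. U 0 j = Uh0 j)"
proof -
  have "(\<forall>j\<in>{1..J}. residual U m j = load F G m j) \<longleftrightarrow>
    (\<forall>j\<in>{1..J - 1}. C_op \<theta> x rh (Dt_bar t U m) j + A_op \<theta> x bh ch (T_avg \<sigma> U m) j = F m j) \<and>
    bh J * dx_bar x (T_avg \<sigma> U m) J
        + step x J * s_minus \<theta> (\<lambda>i. rh J * Dt_bar t U m i + ch J * T_avg \<sigma> U m i) J
      = bh J * S m (\<lambda>k. U k J) + G m" for m
  proof -
    have "{1..J} = insert J {1..J - 1}" using J_pos by auto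
    moreover have "residual U m j = load F G m j \<longleftrightarrow>
        C_op \<theta> x rh (Dt_bar t U m) j + A_op \<theta> x bh ch (T_avg \<sigma> U m) j = F m j"
      if "j \<in> {1..J - 1}" for j
      using that hstep_pos[OF x_mono, of j] by (auto simp: residual_def load_def)
    ultimately show ?thesis
      by (auto simp: residual_def load_def)
  qed
  then show ?thesis
    unfolding scheme_solution_def by blast
qed

lemma energy_linear: "energy (\<lambda>j. u j + a * v j) W = energy u W + a * energy v W"
  by (rule L_form_linear_left)

lemma energy_commute: "U 0 = 0 \<Longrightarrow> W 0 = 0 \<Longrightarrow> energy U W = energy W U"
  by (rule L_form_commute[OF x_mono J_pos])

lemma energy_nonneg: "W 0 = 0 \<Longrightarrow> 0 \<le> energy W W"
  and dx_le_energy: "W 0 = 0 \<Longrightarrow> \<nu> * ip_tilde x J (dx_bar x W) (dx_bar x W) \<le> energy W W"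
proof -
  assume W: "W 0 = 0"
  have "0 \<le> ip_tilde x J (dx_bar x W) (dx_bar x W)"
    unfolding ip_tilde_def using step_pos[OF x_mono]
    by (intro sum_nonneg mult_nonneg_nonneg[OF zero_le_square]) (auto simp: less_imp_le)
  have "\<nu> * ip_tilde x J (dx_bar x W) (dx_bar x W)
      = (\<Sum>j=1..J. \<nu> * (dx_bar x W j * dx_bar x W j * step x j))"
    by (simp add: ip_tilde_def sum_distrib_left)
  also have "\<dots> \<le> (\<Sum>j=1..J. bh j * (dx_bar x W j * dx_bar x W j * step x j))"
    using step_pos[OF x_mono] bh_ge
    by (intro sum_mono mult_right_mono mult_nonneg_nonneg[OF zero_le_square]) (auto simp: less_imp_le)
  also have "\<dots> = ip_tilde x J (\<lambda>j. bh j * dx_bar x W j) (dx_bar x W)"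
    by (simp add: ip_tilde_def mult_ac)
  also have "\<dots> \<le> energy W W"
    using ip_C_nonneg[where W = W and k = ch, OF x_mono J_pos \<theta>_le ch_ge W] by (simp add: L_form_eq)
  finally show le: "\<nu> * ip_tilde x J (dx_bar x W) (dx_bar x W) \<le> energy W W" .
  moreover have "0 \<le> \<nu> * ip_tilde x J (dx_bar x W) (dx_bar x W)"
    using \<open>0 \<le> ip_tilde _ _ _ _\<close> \<nu>_pos by simp
  ultimately show "0 \<le> energy W W" by (rule order_trans[rotated])
qed

lemma mass_nonneg:
  assumes "W 0 = 0"
  shows "0 \<le> mass W W"
  by (rule ip_C_nonneg[where W = W, OF x_mono J_pos \<theta>_le _ assms])
    (rule order_trans[OF less_imp_le[OF \<rho>_low_pos] rh_ge])

lemma energy_norm_square: "W 0 = 0 \<Longrightarrow> (energy_norm W)\<^sup>2 = energy W W"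
  using energy_nonneg by (simp add: norm_L_def)

lemma norm_dx_le:
  assumes "W 0 = 0"
  shows "norm_tilde x J (dx_bar x W) \<le> energy_norm W / sqrt \<nu>"
proof -
  have "norm_tilde x J (dx_bar x W) \<le> sqrt (energy W W / \<nu>)"
    unfolding norm_tilde_def using dx_le_energy[of W] assms \<nu>_pos
    by (intro real_sqrt_le_mono) (simp add: field_simps)
  then show ?thesis by (simp add: norm_L_def real_sqrt_divide)
qed

text \<open>
  The discrete trace inequality, from $W_J=\sum_j\bar\partial_xW_j\,h_j$ and Cauchy-Schwarz; it lets the
  energy norm control the boundary data.
\<close>

lemma boundary_value_le:
  assumes "W 0 = 0"
  shows "\<bar>W J\<bar> \<le> sqrt (x J) * norm_tilde x J (dx_bar x W)"
proof -
  have "W J = (\<Sum>j=1..J. 1 * dx_bar x W j * step x j)"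
  proof -
    have "(\<Sum>j=1..J. 1 * dx_bar x W j * step x j) = (\<Sum>j=1..J. W j - W (j - 1))"
      using step_pos[OF x_mono] by (intro sum.cong refl) (simp add: dx_bar_def less_imp_neq[symmetric])
    then show ?thesis using assms sum_increments[of W J] by simp
  qed
  moreover have "(\<Sum>j=1..J. 1 * 1 * step x j) = x J"
    using sum_increments[of x J] x0 by (simp add: step_def)
  ultimately show ?thesis
    using weighted_Cauchy_Schwarz[of "{1..J}" "step x" "\<lambda>_. 1" "dx_bar x W"] step_pos[OF x_mono]
    by (simp add: norm_tilde_def ip_tilde_def less_imp_le)
qed

lemma energy_zero_imp_zero:
  assumes "W 0 = 0" "energy W W \<le> 0" "j \<le> J"
  shows "W j = 0"
proof -
  have "ip_tilde x J (dx_bar x W) (dx_bar x W) \<le> 0"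
    using order_trans[OF dx_le_energy[of W] assms(2)] assms(1) \<nu>_pos
    by (simp add: mult_le_0_iff)
  moreover have nonneg: "0 \<le> dx_bar x W i * dx_bar x W i * step x i" if "i \<in> {1..J}" for i
    using that step_pos[OF x_mono] by (intro mult_nonneg_nonneg[OF zero_le_square]) (auto simp: less_imp_le)
  ultimately have "(\<Sum>i=1..J. dx_bar x W i * dx_bar x W i * step x i) = 0"
    unfolding ip_tilde_def by (intro antisym sum_nonneg) auto
  then have "\<forall>i\<in>{1..J}. dx_bar x W i * dx_bar x W i * step x i = 0"
    using nonneg by (subst (asm) sum_nonneg_eq_0_iff) auto
  then have "W i = W (i - 1)" if "i \<in> {1..J}" for i
  proof -
    have "0 < step x i" using step_pos[OF x_mono] that by simp
    then show ?thesis using \<open>\<forall>i\<in>{1..J}. _ i\<close> that by (fastforce simp: dx_bar_def)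
  qed
  then have const: "W (Suc i) = W i" if "Suc i \<le> J" for i
    using that by (metis One_nat_def Suc_le_mono atLeastAtMost_iff diff_Suc_1 le0)
  show ?thesis
    using assms(3) by (induction j) (simp_all add: assms(1) const)
qed

text \<open>
  Summation by parts leaves the flux \<open>p J * W J\<close> at the end point, which is the first term of the
  boundary equation and cancels there.
\<close>

lemma weak_form:
  assumes "W 0 = 0"
  shows "(\<Sum>j=1..J. residual U m j * W j)
    = mass (Dt_bar t U m) W + energy (T_avg \<sigma> U m) W - bh J * S m (\<lambda>k. U k J) * W J"
proof -
  let ?D = "Dt_bar t U m" and ?T = "T_avg \<sigma> U m"
  define p where "p = (\<lambda>i. bh i * dx_bar x ?T i)"
  have "residual U m j * W j
      = C_op \<theta> x rh ?D j * W j * hstep x j - (p (j + 1) - p j) * W j + C_op \<theta> x ch ?T j * W j * hstep x j"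
    if "j \<in> {1..J - 1}" for j
  proof -
    have dx: "dx_hat x p j * hstep x j = p (j + 1) - p j"
      using that hstep_pos[OF x_mono, of j] by (simp add: dx_hat_def)
    have "j \<noteq> J" using that by auto
    then show ?thesis
      unfolding dx[symmetric] residual_def A_op_def p_def[symmetric] by (simp add: algebra_simps)
  qed
  then have "(\<Sum>j=1..J - 1. residual U m j * W j)
      = ip_omega x J (C_op \<theta> x rh ?D) W - (\<Sum>j=1..J - 1. (p (j + 1) - p j) * W j)
        + ip_omega x J (C_op \<theta> x ch ?T) W"
    by (simp add: ip_omega_def sum.distrib sum_subtractf)
  moreover have "(\<Sum>j=1..J - 1. (p (j + 1) - p j) * W j)
      = p J * W J - ip_tilde x J p (dx_bar x W)"
  proof -
    have "(\<Sum>j=1..J. p j * (W j - W (j - 1))) = ip_tilde x J p (dx_bar x W)"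
      unfolding ip_tilde_def using step_pos[OF x_mono]
      by (intro sum.cong refl) (simp add: dx_bar_def less_imp_neq[symmetric])
    then show ?thesis using summation_by_parts[where W = W, OF J_pos assms, of p] by simp
  qed
  ultimately show ?thesis
    unfolding sum_split_last[OF J_pos]
    by (simp add: residual_def ip_C_def L_form_def s_minus_def p_def algebra_simps)
qed

text \<open>
  With $d=\bar\partial_tU^m$ both $U^m$ and $U^{(\sigma)m}$ are $U^{m-1}$ plus a multiple of $d$, namely
  $\tau_m d$ and $\sigma\tau_m d$; expanding the symmetric form leaves the multiple $2\sigma-1$ of the
  square of $\tau_m d$.
\<close>

lemma energy_increment:
  assumes "1 \<le> m" "U m 0 = 0" "U (m - 1) 0 = 0"
  shows "2 * step t m * energy (T_avg \<sigma> U m) (Dt_bar t U m)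
    = energy (U m) (U m) - energy (U (m - 1)) (U (m - 1))
      + 2 * (\<sigma> - 1/2) * (step t m)\<^sup>2 * energy (Dt_bar t U m) (Dt_bar t U m)"
proof -
  define \<tau> u d where "\<tau> = step t m" and "u = U (m - 1)" and "d = Dt_bar t U m"
  have "\<tau> \<noteq> 0" using tau_pos[OF assms(1)] by (simp add: \<tau>_def)
  have Um: "U m = (\<lambda>j. u j + \<tau> * d j)"
    using \<open>\<tau> \<noteq> 0\<close> by (auto simp: u_def d_def Dt_bar_def dt_bar_def \<tau>_def)
  have T: "T_avg \<sigma> U m = (\<lambda>j. u j + \<sigma> * \<tau> * d j)"
    by (rule ext) (simp only: T_avg_def t_avg_def Um u_def[symmetric], simp add: algebra_simps)
  have zero: "u 0 = 0" "d 0 = 0"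
    using assms by (simp_all add: u_def d_def Dt_bar_def dt_bar_def)
  have "energy (U m) (U m) = energy u (U m) + \<tau> * energy d (U m)"
    by (subst (1) Um) (rule energy_linear)
  also have "energy u (U m) = energy (U m) u"
    by (rule energy_commute[of u "U m", OF zero(1) assms(2)])
  also have "\<dots> = energy u u + \<tau> * energy d u"
    unfolding Um by (rule energy_linear)
  also have "energy d (U m) = energy (U m) d"
    by (rule energy_commute[of d "U m", OF zero(2) assms(2)])
  also have "\<dots> = energy u d + \<tau> * energy d d"
    unfolding Um by (rule energy_linear)
  also have "energy d u = energy u d"
    by (rule energy_commute[of d u, OF zero(2,1)])
  finally have "energy (U m) (U m) = energy u u + 2 * \<tau> * energy u d + \<tau>\<^sup>2 * energy d d"
    by (simp add: power2_eq_square algebra_simps)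
  moreover have "energy (T_avg \<sigma> U m) d = energy u d + \<sigma> * \<tau> * energy d d"
    unfolding T by (rule energy_linear)
  ultimately show ?thesis
    unfolding \<tau>_def[symmetric] u_def[symmetric] d_def[symmetric]
    by (simp add: power2_eq_square algebra_simps)
qed

section \<open>The a priori bound\<close>

text \<open>
  The functional by which the data $F^{(1)}$ and \<open>G\<close> act on \<open>W\<close>.  Having passed the difference to \<open>W\<close>, it
  is bounded in the energy norm of \<open>W\<close>.
\<close>

definition flux :: "(nat \<Rightarrow> real) \<Rightarrow> real \<Rightarrow> (nat \<Rightarrow> real) \<Rightarrow> real" where
  "flux f g W = g * W J - ip_tilde x J f (dx_bar x W)"

lemma flux_bound:
  assumes "W 0 = 0"
  shows "\<bar>flux f g W\<bar> \<le> (norm_tilde x J f + sqrt (x J) * \<bar>g\<bar>) * (energy_norm W / sqrt \<nu>)"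
proof -
  have CS: "\<bar>ip_tilde x J f (dx_bar x W)\<bar> \<le> norm_tilde x J f * norm_tilde x J (dx_bar x W)"
    unfolding ip_tilde_def norm_tilde_def using step_pos[OF x_mono]
    by (intro weighted_Cauchy_Schwarz) (simp add: less_imp_le)
  have "\<bar>flux f g W\<bar> \<le> \<bar>g\<bar> * \<bar>W J\<bar> + \<bar>ip_tilde x J f (dx_bar x W)\<bar>"
    unfolding flux_def by (simp add: abs_mult[symmetric])
  also have "\<dots> \<le> \<bar>g\<bar> * (sqrt (x J) * norm_tilde x J (dx_bar x W))
      + norm_tilde x J f * norm_tilde x J (dx_bar x W)"
    by (intro add_mono mult_left_mono boundary_value_le CS assms abs_ge_zero)
  also have "\<dots> = (norm_tilde x J f + sqrt (x J) * \<bar>g\<bar>) * norm_tilde x J (dx_bar x W)"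
    by (simp add: algebra_simps)
  also have "\<dots> \<le> (norm_tilde x J f + sqrt (x J) * \<bar>g\<bar>) * (energy_norm W / sqrt \<nu>)"
    by (intro mult_left_mono norm_dx_le assms add_nonneg_nonneg mult_nonneg_nonneg
        norm_tilde_nonneg real_sqrt_ge_zero x_J_nonneg abs_ge_zero)
  finally show ?thesis .
qed

lemma flux_diff_data:
  assumes "1 \<le> m"
  shows "flux (F m) (G m) W - flux (F (m - 1)) (G (m - 1)) W
    = step t m * flux (Dt_bar t F m) (dt_bar t G m) W"
proof -
  have "F m j = F (m - 1) j + step t m * Dt_bar t F m j" for j
    using tau_pos[OF assms] by (simp add: Dt_bar_def dt_bar_def)
  moreover have "G m = G (m - 1) + step t m * dt_bar t G m"
    using tau_pos[OF assms] by (simp add: dt_bar_def)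
  ultimately show ?thesis
    by (simp add: flux_def ip_tilde_def sum.distrib sum_distrib_left algebra_simps)
qed

lemma flux_diff_argument:
  assumes "1 \<le> m"
  shows "step t m * flux f g (Dt_bar t U m) = flux f g (U m) - flux f g (U (m - 1))"
proof -
  have "U m j = U (m - 1) j + step t m * Dt_bar t U m j" for j
    using tau_pos[OF assms] by (simp add: Dt_bar_def dt_bar_def)
  then have "dx_bar x (U m) j = dx_bar x (U (m - 1)) j + step t m * dx_bar x (Dt_bar t U m) j"
    "U m J = U (m - 1) J + step t m * Dt_bar t U m J" for j
    by (simp_all add: dx_bar_def add_divide_distrib[symmetric] algebra_simps)
  then show ?thesis
    by (simp add: flux_def ip_tilde_def sum.distrib sum_distrib_left algebra_simps)
qed

text \<open>
  Since $F^{(1)}$ vanishes at node \<open>J\<close>, the summation by parts of its difference leaves no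
  boundary term.
\<close>

lemma load_pairing:
  assumes "W 0 = 0" "F1 m J = 0"
    and "\<forall>j\<in>{1..J - 1}. F m j = F0 m j + dx_hat x (F1 m) j"
  shows "(\<Sum>j=1..J. load F G m j * W j) = ip_omega x J (F0 m) W + flux (F1 m) (G m) W"
proof -
  have "load F G m j * W j = F0 m j * W j * hstep x j + (F1 m (j + 1) - F1 m j) * W j"
    if j: "j \<in> {1..J - 1}" for j
  proof -
    have dx: "dx_hat x (F1 m) j * hstep x j = F1 m (j + 1) - F1 m j"
      using j hstep_pos[OF x_mono, of j] by (simp add: dx_hat_def)
    have "j \<noteq> J" using j by auto
    then show ?thesis
      using assms(3) j unfolding dx[symmetric] by (simp add: load_def algebra_simps)
  qed
  then have "(\<Sum>j=1..J - 1. load F G m j * W j)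
      = ip_omega x J (F0 m) W + (\<Sum>j=1..J - 1. (F1 m (j + 1) - F1 m j) * W j)"
    by (simp add: ip_omega_def sum.distrib)
  moreover have "(\<Sum>j=1..J. F1 m j * (W j - W (j - 1))) = ip_tilde x J (F1 m) (dx_bar x W)"
    unfolding ip_tilde_def using step_pos[OF x_mono]
    by (intro sum.cong refl) (simp add: dx_bar_def less_imp_neq[symmetric])
  moreover have "(\<Sum>j=1..J. load F G m j * W j) = (\<Sum>j=1..J - 1. load F G m j * W j) + G m * W J"
    unfolding sum_split_last[OF J_pos] by (simp add: load_def)
  ultimately show ?thesis
    using summation_by_parts[where W = W, OF J_pos assms(1), of "F1 m"] assms(2)
    by (simp add: flux_def)
qed

definition dissipation :: "(nat \<Rightarrow> nat \<Rightarrow> real) \<Rightarrow> nat \<Rightarrow> real" where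
  "dissipation U n = (\<Sum>m=1..n. ((\<sigma> - 1/2) * step t m * energy (Dt_bar t U m) (Dt_bar t U m)
      + mass (Dt_bar t U m) (Dt_bar t U m)) * step t m)"

text \<open>
  The choice \<open>W = Dt_bar t U m\<close> in the weak form, summed over time.  Dissipativity of \<open>S\<close> applies to the
  boundary trace because the initial data vanish at node \<open>J\<close>.
\<close>

lemma energy_inequality:
  assumes sol: "solution F G Uh0 U" and "Uh0 0 = 0" "Uh0 J = 0"
    and decomp: "\<forall>m\<ge>1. \<forall>j\<in>{1..J - 1}. F m j = F0 m j + dx_hat x (F1 m) j"
    and "\<forall>m. F1 m J = 0"
  shows "energy (U n) (U n) + 2 * dissipation U n
    \<le> energy (U 0) (U 0) + 2 * (\<Sum>m=1..n. ip_omega x J (F0 m) (Dt_bar t U m) * step t m)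
      + 2 * (\<Sum>m=1..n. flux (F1 m) (G m) (U m) - flux (F1 m) (G m) (U (m - 1)))"
proof -
  have U0: "U m 0 = 0" for m
    using sol assms(2) unfolding solution_iff by (cases "m = 0") auto
  have UJ: "U 0 J = 0"
    using sol assms(3) unfolding solution_iff by auto
  let ?\<Phi> = "\<lambda>k. U k J"
  have step: "(energy (U m) (U m) - energy (U (m - 1)) (U (m - 1)))
        + 2 * (((\<sigma> - 1/2) * step t m * energy (Dt_bar t U m) (Dt_bar t U m)
          + mass (Dt_bar t U m) (Dt_bar t U m)) * step t m)
      = 2 * (ip_omega x J (F0 m) (Dt_bar t U m) * step t m)
        + 2 * (flux (F1 m) (G m) (U m) - flux (F1 m) (G m) (U (m - 1)))
        + 2 * bh J * (S m ?\<Phi> * dt_bar t ?\<Phi> m * step t m)"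
    if m: "m \<in> {1..n}" for m
  proof -
    have m1: "1 \<le> m" using m by simp
    let ?D = "Dt_bar t U m"
    have D0: "?D 0 = 0" by (simp add: Dt_bar_def dt_bar_def U0)
    have "mass ?D ?D + energy (T_avg \<sigma> U m) ?D - bh J * S m ?\<Phi> * ?D J
        = (\<Sum>j=1..J. load F G m j * ?D j)"
      using sol m1 unfolding weak_form[of ?D, OF D0, symmetric] solution_iff by simp
    also have "\<dots> = ip_omega x J (F0 m) ?D + flux (F1 m) (G m) ?D"
      using decomp assms(5) m1 D0 by (intro load_pairing) auto
    finally have "2 * step t m * mass ?D ?D + 2 * step t m * energy (T_avg \<sigma> U m) ?D
        = 2 * step t m * ip_omega x J (F0 m) ?D + 2 * (step t m * flux (F1 m) (G m) ?D)
          + 2 * step t m * (bh J * S m ?\<Phi> * ?D J)"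
      by algebra
    then show ?thesis
      unfolding energy_increment[where U = U, OF m1 U0 U0] flux_diff_argument[OF m1]
      by (simp add: Dt_bar_def power2_eq_square algebra_simps)
  qed
  have "(\<Sum>m=1..n. S m ?\<Phi> * dt_bar t ?\<Phi> m * step t m) \<le> 0"
    using S_dissipative[of ?\<Phi> n] UJ by (cases "n = 0") auto
  then have "2 * bh J * (\<Sum>m=1..n. S m ?\<Phi> * dt_bar t ?\<Phi> m * step t m) \<le> 0"
    using bh_ge[of J] J_pos \<nu>_pos by (simp add: mult_le_0_iff)
  moreover have "(\<Sum>m=1..n. energy (U m) (U m) - energy (U (m - 1)) (U (m - 1))) + 2 * dissipation U n
      = 2 * (\<Sum>m=1..n. ip_omega x J (F0 m) (Dt_bar t U m) * step t m)
        + 2 * (\<Sum>m=1..n. flux (F1 m) (G m) (U m) - flux (F1 m) (G m) (U (m - 1)))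
        + 2 * bh J * (\<Sum>m=1..n. S m ?\<Phi> * dt_bar t ?\<Phi> m * step t m)"
    unfolding dissipation_def sum_distrib_left sum.distrib[symmetric]
    by (intro sum.cong refl step)
  ultimately show ?thesis
    unfolding sum_increments[of "\<lambda>m. energy (U m) (U m)"] by linarith
qed

text \<open>
  Summation by parts in time.  Writing \<open>B m k\<close> for the data of level \<open>m\<close> paired with \<open>U k\<close>, the sum
  contains time differences of \<open>U\<close>; it is rearranged so that only \<open>B 0 k\<close> and differences of \<open>B\<close> in its
  first index remain, which \<open>flux_bound\<close> estimates by multiples of \<open>Y\<close>.  The final term \<open>B n n\<close> is
  itself expanded from level \<open>0\<close>, so that the data of each level occur twice: hence the factor \<open>2\<close>.
\<close>

lemma flux_sum_bound:
  assumes "n \<le> M" "\<And>m. m \<le> M \<Longrightarrow> U m 0 = 0" "\<And>m. m \<le> M \<Longrightarrow> energy_norm (U m) \<le> Y"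
  shows "(\<Sum>m=1..n. flux (F m) (G m) (U m) - flux (F m) (G m) (U (m - 1)))
    \<le> 2 / sqrt \<nu> * (norm_tilde x J (F 0) + (\<Sum>m=1..M. norm_tilde x J (Dt_bar t F m) * step t m)
               + sqrt (x J) * (\<bar>G 0\<bar> + (\<Sum>m=1..M. \<bar>dt_bar t G m\<bar> * step t m))) * Y"
proof -
  define B where "B = (\<lambda>m k. flux (F m) (G m) (U k))"
  define a where "a = (\<lambda>m. norm_tilde x J (Dt_bar t F m) + sqrt (x J) * \<bar>dt_bar t G m\<bar>)"
  define a0 where "a0 = norm_tilde x J (F 0) + sqrt (x J) * \<bar>G 0\<bar>"
  define y where "y = Y / sqrt \<nu>"
  have norm_nonneg: "0 \<le> norm_tilde x J f + sqrt (x J) * \<bar>g\<bar>" for f g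
    using norm_tilde_nonneg x_J_nonneg by simp
  have bound: "\<bar>flux f g (U k)\<bar> \<le> (norm_tilde x J f + sqrt (x J) * \<bar>g\<bar>) * y" if "k \<le> M" for f g k
    using flux_bound[of "U k" f g] assms(2,3)[OF that] norm_nonneg[of f g] \<nu>_pos
    unfolding y_def by (smt (verit) divide_right_mono mult_left_mono real_sqrt_ge_zero)
  have B0: "\<bar>B 0 k\<bar> \<le> a0 * y" if "k \<le> M" for k
    unfolding B_def a0_def by (rule bound[OF that])
  have dB: "\<bar>B m k - B (m - 1) k\<bar> \<le> a m * step t m * y" if "1 \<le> m" "k \<le> M" for m k
  proof -
    have "\<bar>B m k - B (m - 1) k\<bar> = step t m * \<bar>flux (Dt_bar t F m) (dt_bar t G m) (U k)\<bar>"
      using tau_pos[OF that(1)] unfolding B_def flux_diff_data[OF that(1)] by (simp add: abs_mult)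
    also have "\<dots> \<le> step t m * (a m * y)"
      unfolding a_def using tau_pos[OF that(1)] that(2) by (intro mult_left_mono bound) auto
    finally show ?thesis by (simp add: mult_ac)
  qed
  have "(\<Sum>m=1..n. B m m - B m (m - 1))
      = (\<Sum>m=1..n. (B m m - B (m - 1) (m - 1)) - (B m (m - 1) - B (m - 1) (m - 1)))"
    by simp
  also have "\<dots> = B n n - B 0 0 - (\<Sum>m=1..n. B m (m - 1) - B (m - 1) (m - 1))"
    unfolding sum_subtractf[of "\<lambda>m. B m m - B (m - 1) (m - 1)"] sum_increments[of "\<lambda>m. B m m"] ..
  also have "B n n = B 0 n + (\<Sum>m=1..n. B m n - B (m - 1) n)"
    using sum_increments[of "\<lambda>m. B m n" n] by simp
  finally have "(\<Sum>m=1..n. B m m - B m (m - 1)) = (B 0 n - B 0 0)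
      + ((\<Sum>m=1..n. B m n - B (m - 1) n) - (\<Sum>m=1..n. B m (m - 1) - B (m - 1) (m - 1)))"
    by simp
  also have "\<dots> = (B 0 n - B 0 0)
      + (\<Sum>m=1..n. (B m n - B (m - 1) n) - (B m (m - 1) - B (m - 1) (m - 1)))"
    by (simp only: sum_subtractf)
  also have "\<dots> \<le> 2 * (a0 * y) + (\<Sum>m=1..n. 2 * (a m * step t m * y))"
  proof (intro add_mono sum_mono)
    show "B 0 n - B 0 0 \<le> 2 * (a0 * y)"
      using B0[of n] B0[of 0] assms(1) by (simp add: abs_le_iff)
  next
    fix m assume "m \<in> {1..n}"
    then have m: "1 \<le> m" "n \<le> M" "m - 1 \<le> M" using assms(1) by auto
    show "(B m n - B (m - 1) n) - (B m (m - 1) - B (m - 1) (m - 1)) \<le> 2 * (a m * step t m * y)"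
      using dB[OF m(1,2)] dB[OF m(1,3)] by linarith
  qed
  also have "\<dots> \<le> 2 * (a0 * y) + (\<Sum>m=1..M. 2 * (a m * step t m * y))"
  proof (intro add_left_mono sum_mono2)
    fix m assume "m \<in> {1..M} - {1..n}"
    then have "1 \<le> m" "m \<le> M" by auto
    then show "0 \<le> 2 * (a m * step t m * y)"
      using dB[of m 0] by linarith
  qed (use assms(1) in auto)
  also have "\<dots> = 2 * (a0 * y + (\<Sum>m=1..M. a m * step t m * y))"
    by (simp add: sum_distrib_left)
  also have "\<dots> = 2 / sqrt \<nu> * (norm_tilde x J (F 0) + (\<Sum>m=1..M. norm_tilde x J (Dt_bar t F m) * step t m)
               + sqrt (x J) * (\<bar>G 0\<bar> + (\<Sum>m=1..M. \<bar>dt_bar t G m\<bar> * step t m))) * Y"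
    unfolding sum_distrib_right[symmetric] a0_def a_def y_def
    by (simp add: distrib_right sum.distrib sum_distrib_left algebra_simps add_divide_distrib)
  finally show ?thesis unfolding B_def .
qed

text \<open>
  The constant \<open>\<gamma>\<close> expresses that the mass norm controls $F^{(0)}$: it is $(c_\theta\underline\rho)^{-1/2}$
  for $\theta<\frac14$, while for $\theta=\frac14$, where the mass norm bounds the nodal values only with mesh-dependent constants,
  $F^{(0)}=0$ and \<open>\<gamma> = 0\<close>.
\<close>

theorem a_priori_bound:
  assumes sol: "solution F G Uh0 U" and Uh0: "Uh0 0 = 0" "Uh0 J = 0"
    and decomp: "\<forall>m\<ge>1. \<forall>j\<in>{1..J - 1}. F m j = F0 m j + dx_hat x (F1 m) j"
    and F1_J: "\<forall>m. F1 m J = 0"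
    and \<gamma>: "0 \<le> \<gamma>"
      "\<And>m W. W 0 = 0 \<Longrightarrow> ip_omega x J (F0 m) W \<le> \<gamma> * norm_omega x J (F0 m) * norm_C \<theta> x J rh W"
  shows "max (MAX m\<in>{0..M}. energy_norm (U m))
      (sqrt 2 * norm_two \<sigma> \<theta> x J rh bh ch (ch J) t M U)
    \<le> energy_norm Uh0 + sqrt 2 * \<gamma> * norm_omega_time x J t M F0
      + 4 / sqrt \<nu> *
        (norm_tilde x J (F1 0) + (\<Sum>m=1..M. norm_tilde x J (Dt_bar t F1 m) * step t m)
         + sqrt (x J) * (\<bar>G 0\<bar> + (\<Sum>m=1..M. \<bar>dt_bar t G m\<bar> * step t m)))"
    (is "?Y \<le> energy_norm Uh0 + sqrt 2 * \<gamma> * ?F + 4 / sqrt \<nu> * ?N")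
proof -
  have U0: "U m 0 = 0" for m
    using sol Uh0 unfolding solution_iff by (cases "m = 0") auto
  have D0: "Dt_bar t U m 0 = 0" for m
    by (simp add: Dt_bar_def dt_bar_def U0)
  have E0: "energy_norm (U 0) = energy_norm Uh0"
    using L_form_cong[OF J_pos, of "U 0" Uh0 "U 0" Uh0] sol unfolding solution_iff norm_L_def by simp
  define q where "q = (\<lambda>m. ((\<sigma> - 1/2) * step t m * energy (Dt_bar t U m) (Dt_bar t U m)
      + mass (Dt_bar t U m) (Dt_bar t U m)) * step t m)"
  have q_ge: "mass (Dt_bar t U m) (Dt_bar t U m) * step t m \<le> q m" if "1 \<le> m" for m
    using \<sigma>_ge tau_pos[OF that] energy_nonneg[where W = "Dt_bar t U m", OF D0]
    unfolding q_def by (intro mult_right_mono) auto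
  have mass_sq: "(norm_C \<theta> x J rh (Dt_bar t U m))\<^sup>2 = mass (Dt_bar t U m) (Dt_bar t U m)" for m
    using mass_nonneg[where W = "Dt_bar t U m", OF D0] by (simp add: norm_C_def)
  have q_nonneg: "0 \<le> q m" if "1 \<le> m" for m
    using q_ge[OF that] mass_nonneg[where W = "Dt_bar t U m", OF D0] tau_pos[OF that]
    by (smt (verit) mult_nonneg_nonneg)
  have diss_eq: "dissipation U n = (\<Sum>m=1..n. q m)" for n
    by (simp add: dissipation_def q_def)
  have norm_two_eq: "norm_two \<sigma> \<theta> x J rh bh ch (ch J) t M U = sqrt (dissipation U M)"
    unfolding norm_two_def dissipation_def mass_sq energy_norm_square[where W = "Dt_bar t U _", OF D0] ..
  have diss_mono: "dissipation U n \<le> dissipation U M" if "n \<le> M" for n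
    unfolding diss_eq using that q_nonneg by (intro sum_mono2) auto
  have diss_nonneg: "0 \<le> dissipation U n" for n
    unfolding diss_eq using q_nonneg by (intro sum_nonneg) auto
  define Y where "Y = ?Y"
  have E_le: "energy_norm (U m) \<le> Y" if "m \<le> M" for m
    unfolding Y_def using that by (intro max.coboundedI1 Max_ge) auto
  have diss_le: "sqrt 2 * sqrt (dissipation U M) \<le> Y"
    unfolding Y_def norm_two_eq by simp
  have Y_nonneg: "0 \<le> Y"
    using diss_le diss_nonneg[of M] by (smt (verit) mult_nonneg_nonneg real_sqrt_ge_zero)
  have source: "(\<Sum>m=1..n. ip_omega x J (F0 m) (Dt_bar t U m) * step t m) \<le> \<gamma> * ?F * (Y / sqrt 2)"
    if "n \<le> M" for n
  proof -
    have st: "0 \<le> step t m" if "m \<in> {1..k}" for m k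
      using tau_pos that by (simp add: less_imp_le)
    have "(\<Sum>m=1..n. ip_omega x J (F0 m) (Dt_bar t U m) * step t m)
        \<le> (\<Sum>m=1..n. \<gamma> * (norm_omega x J (F0 m) * norm_C \<theta> x J rh (Dt_bar t U m) * step t m))"
    proof (rule sum_mono)
      fix m assume "m \<in> {1..n}"
      then show "ip_omega x J (F0 m) (Dt_bar t U m) * step t m
          \<le> \<gamma> * (norm_omega x J (F0 m) * norm_C \<theta> x J rh (Dt_bar t U m) * step t m)"
        using mult_right_mono[OF \<gamma>(2)[where W = "Dt_bar t U m", OF D0] st, of m n m] by (simp add: mult_ac)
    qed
    also have "\<dots> \<le> \<gamma> * (sqrt (\<Sum>m=1..n. norm_omega x J (F0 m) * norm_omega x J (F0 m) * step t m)
        * sqrt (\<Sum>m=1..n. norm_C \<theta> x J rh (Dt_bar t U m) * norm_C \<theta> x J rh (Dt_bar t U m) * step t m))"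
      unfolding sum_distrib_left[symmetric]
      by (intro mult_left_mono \<gamma>(1) order_trans[OF abs_ge_self weighted_Cauchy_Schwarz] st)
    also have "\<dots> \<le> \<gamma> * (?F * sqrt (dissipation U M))"
    proof (intro mult_left_mono[OF _ \<gamma>(1)] mult_mono)
      show "sqrt (\<Sum>m=1..n. norm_omega x J (F0 m) * norm_omega x J (F0 m) * step t m) \<le> ?F"
        unfolding norm_omega_time_def power2_eq_square using that st
        by (intro real_sqrt_le_mono sum_mono2 mult_nonneg_nonneg[OF zero_le_square]) auto
      have "(\<Sum>m=1..n. norm_C \<theta> x J rh (Dt_bar t U m) * norm_C \<theta> x J rh (Dt_bar t U m) * step t m)
          \<le> dissipation U n"
        unfolding diss_eq power2_eq_square[symmetric] mass_sq using q_ge by (intro sum_mono) auto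
      then show "sqrt (\<Sum>m=1..n. norm_C \<theta> x J rh (Dt_bar t U m) * norm_C \<theta> x J rh (Dt_bar t U m) * step t m)
          \<le> sqrt (dissipation U M)"
        using diss_mono[OF that] by simp
      show "0 \<le> ?F" by (rule norm_omega_time_nonneg)
      show "0 \<le> sqrt (\<Sum>m=1..n. norm_C \<theta> x J rh (Dt_bar t U m) * norm_C \<theta> x J rh (Dt_bar t U m) * step t m)"
        using st by (intro real_sqrt_ge_zero sum_nonneg mult_nonneg_nonneg[OF zero_le_square]) auto
    qed
    also have "\<dots> \<le> \<gamma> * (?F * (Y / sqrt 2))"
    proof (intro mult_left_mono \<gamma>(1))
      show "sqrt (dissipation U M) \<le> Y / sqrt 2"
        using diss_le by (simp add: field_simps)
      show "0 \<le> ?F" by (rule norm_omega_time_nonneg)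
    qed
    finally show ?thesis by (simp add: mult_ac)
  qed
  define R where "R = energy_norm Uh0 + sqrt 2 * \<gamma> * ?F + 4 / sqrt \<nu> * ?N"
  have main: "energy (U n) (U n) + 2 * dissipation U n \<le> R * Y" if "n \<le> M" for n
  proof -
    have "energy (U n) (U n) + 2 * dissipation U n
        \<le> energy (U 0) (U 0) + 2 * (\<gamma> * ?F * (Y / sqrt 2)) + 2 * (2 / sqrt \<nu> * ?N * Y)"
      using energy_inequality[where U = U and n = n, OF sol Uh0 decomp F1_J] source[OF that]
        flux_sum_bound[of n M U Y F1 G, OF that U0 E_le] by linarith
    moreover have "energy (U 0) (U 0) \<le> energy_norm Uh0 * Y"
    proof -
      have "energy_norm (U 0) * energy_norm (U 0) \<le> energy_norm (U 0) * Y"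
        using energy_nonneg[where W = "U 0", OF U0]
        by (intro mult_left_mono E_le) (simp_all add: norm_L_def)
      then show ?thesis
        using energy_norm_square[where W = "U 0", OF U0] by (simp add: E0 power2_eq_square)
    qed
    moreover have "2 * (\<gamma> * ?F * (Y / sqrt 2)) = sqrt 2 * \<gamma> * ?F * Y"
      by (simp add: field_simps)
    moreover have "2 * (2 / sqrt \<nu> * ?N * Y) = 4 / sqrt \<nu> * ?N * Y" by simp
    ultimately show ?thesis
      unfolding R_def distrib_right by linarith
  qed
  (* if Y is one of the energy norms, the inequality is used at that level; otherwise at level M *)
  have "Y * Y \<le> R * Y"
  proof (cases "Y = (MAX m\<in>{0..M}. energy_norm (U m))")
    case True
    then have "Y \<in> (\<lambda>m. energy_norm (U m)) ` {0..M}"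
      by (metis Max_in atLeastAtMost_iff empty_iff finite_atLeastAtMost finite_imageI image_is_empty le0)
    then obtain n where n: "n \<le> M" "Y = energy_norm (U n)" by auto
    then show ?thesis
      using main[OF n(1)] diss_nonneg[of n] energy_norm_square[where W = "U n", OF U0]
      by (simp add: power2_eq_square)
  next
    case False
    moreover have "max p r = p \<or> max p r = r" for p r :: real
      by (simp add: max_def)
    ultimately have "Y = sqrt 2 * sqrt (dissipation U M)"
      unfolding Y_def norm_two_eq by blast
    then have "Y * Y = 2 * dissipation U M"
      using diss_nonneg[of M] by (simp add: mult_ac flip: real_sqrt_mult)
    then show ?thesis
      using main[of M] energy_nonneg[where W = "U M", OF U0] by simp
  qed
  moreover have "0 \<le> R"
  proof -
    have "0 \<le> energy_norm Uh0"
      using energy_nonneg[where W = Uh0] Uh0 by (simp add: norm_L_def)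
    moreover have "0 \<le> ?N"
      using norm_tilde_nonneg x_J_nonneg tau_pos
      by (intro add_nonneg_nonneg mult_nonneg_nonneg sum_nonneg) (auto simp: less_imp_le)
    then have "0 \<le> 4 / sqrt \<nu> * ?N"
      using \<nu>_pos by (intro mult_nonneg_nonneg) simp_all
    moreover have "0 \<le> sqrt 2 * \<gamma> * ?F"
      using \<gamma>(1) norm_omega_time_nonneg by simp
    ultimately show ?thesis
      unfolding R_def by linarith
  qed
  ultimately have "Y \<le> R"
    using Y_nonneg by (cases "Y = 0") auto
  then show ?thesis unfolding Y_def R_def .
qed

section \<open>Unique solvability\<close>

lemma residual_linear:
  assumes "1 \<le> m"
  shows "residual (\<lambda>k i. U k i + a * V k i) m j = residual U m j + a * residual V m j"
proof -
  have D: "Dt_bar t (\<lambda>k i. U k i + a * V k i) m = (\<lambda>i. Dt_bar t U m i + a * Dt_bar t V m i)"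
    by (rule ext) (simp add: Dt_bar_def dt_bar_def add_divide_distrib diff_divide_distrib algebra_simps)
  have T: "T_avg \<sigma> (\<lambda>k i. U k i + a * V k i) m = (\<lambda>i. T_avg \<sigma> U m i + a * T_avg \<sigma> V m i)"
    by (rule ext) (simp add: T_avg_def t_avg_def algebra_simps)
  have S: "S m (\<lambda>k. U k J + a * V k J) = S m (\<lambda>k. U k J) + a * S m (\<lambda>k. V k J)"
    using S_linear[OF assms] unfolding linear_upto_def by simp
  have C: "C_op \<theta> x k (\<lambda>i. u i + a * v i) j = C_op \<theta> x k u j + a * C_op \<theta> x k v j" for k u v
    by (simp add: C_op_def add_divide_distrib algebra_simps)
  have dx: "dx_bar x (\<lambda>i. u i + a * v i) i = dx_bar x u i + a * dx_bar x v i" for u v i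
    by (simp add: dx_bar_def add_divide_distrib diff_divide_distrib algebra_simps)
  have A: "A_op \<theta> x bh ch (\<lambda>i. u i + a * v i) j = A_op \<theta> x bh ch u j + a * A_op \<theta> x bh ch v j" for u v
    by (simp add: A_op_def C dx dx_hat_def add_divide_distrib diff_divide_distrib algebra_simps)
  show ?thesis
    unfolding residual_def D T S C A dx by (simp add: s_minus_def algebra_simps)
qed

lemma residual_causal:
  assumes "1 \<le> m" "\<forall>k\<le>m. U k = V k"
  shows "residual U m j = residual V m j"
proof -
  have "Dt_bar t U m = Dt_bar t V m" "T_avg \<sigma> U m = T_avg \<sigma> V m"
    using assms(2) by (auto simp: Dt_bar_def dt_bar_def T_avg_def t_avg_def fun_eq_iff)
  moreover have "S m (\<lambda>k. U k J) = S m (\<lambda>k. V k J)"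
    using S_linear[OF assms(1)] assms(2) unfolding linear_upto_def by simp
  ultimately show ?thesis by (simp add: residual_def)
qed

text \<open>
  Dissipativity on a sequence whose only nonzero entry is at level \<open>m\<close>, summed up to \<open>m\<close>: all earlier
  summands vanish, so the last one alone is nonpositive.
\<close>

lemma S_newest_level:
  assumes "1 \<le> m"
  shows "S m (\<lambda>k. if k = m then v else 0) * v \<le> 0"
proof -
  let ?\<Phi> = "\<lambda>k. if k = m then v else (0::real)"
  have "S k ?\<Phi> * dt_bar t ?\<Phi> k * step t k = 0" if "k \<in> {1..m - 1}" for k
  proof -
    have "k \<noteq> m" "k - 1 \<noteq> m" using that by auto
    then show ?thesis by (simp add: dt_bar_def)
  qed
  then have "(\<Sum>k=1..m - 1. S k ?\<Phi> * dt_bar t ?\<Phi> k * step t k) = 0"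
    by (rule sum.neutral[rule_format])
  moreover have "dt_bar t ?\<Phi> m * step t m = v"
    using assms tau_pos[OF assms] by (simp add: dt_bar_def)
  ultimately show ?thesis
    using S_dissipative[of ?\<Phi> m] assms sum_split_last[OF assms, of "\<lambda>k. S k ?\<Phi> * dt_bar t ?\<Phi> k * step t k"]
    by (simp add: mult.assoc)
qed

text \<open>
  For a function of one time level the weak form, with the level itself as test function, is
  $\tau_m^{-1}$ times the mass form plus \<open>\<sigma>\<close> times the energy form minus the nonpositive term of \<open>S\<close>.
  If it vanishes, so does the energy, and \<open>\<sigma> > 0\<close>.
\<close>

lemma residual_definite:
  assumes "1 \<le> m" and supp: "\<forall>j. j \<notin> {1..J} \<longrightarrow> w j = 0"
    and zero: "(\<Sum>j=1..J. w j * residual (\<lambda>k. if k = m then w else (\<lambda>_. 0)) m j) = 0"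
  shows "w j = 0"
proof -
  let ?U = "\<lambda>k. if k = m then w else (\<lambda>_. 0)"
  have w0: "w 0 = 0" using supp by simp
  have prev: "m - Suc 0 \<noteq> m" using assms(1) by simp
  (* the summand 0 stands for the previous level and gives the shape u + a * v of the linearity laws *)
  have D: "Dt_bar t ?U m = (\<lambda>i. 0 + 1 / step t m * w i)"
    by (rule ext) (simp add: Dt_bar_def dt_bar_def prev)
  have T: "T_avg \<sigma> ?U m = (\<lambda>i. 0 + \<sigma> * w i)"
    by (rule ext) (simp add: T_avg_def t_avg_def prev)
  have zeros: "mass (\<lambda>i. 0) w = 0" "energy (\<lambda>i. 0) w = 0"
    by (simp_all add: L_form_eq ip_C_def ip_omega_def ip_tilde_def C_op_def s_minus_def dx_bar_def)
  have "0 = mass w w / step t m + \<sigma> * energy w w - bh J * S m (\<lambda>k. ?U k J) * w J"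
    using weak_form[where W = w, OF w0, of ?U m] zero
    unfolding D T ip_C_linear_left energy_linear zeros by (simp add: mult.commute)
  moreover have "(\<lambda>k. ?U k J) = (\<lambda>k. if k = m then w J else 0)" by auto
  moreover have "bh J * (S m (\<lambda>k. if k = m then w J else 0) * w J) \<le> 0"
    using bh_ge[of J] J_pos \<nu>_pos
    by (intro mult_nonneg_nonpos S_newest_level assms(1)) auto
  moreover have "0 \<le> mass w w / step t m"
    using mass_nonneg[where W = w, OF w0] tau_pos[OF assms(1)] by simp
  ultimately have "\<sigma> * energy w w \<le> 0" by (simp add: mult.assoc)
  then have "energy w w \<le> 0"
    using \<sigma>_ge by (simp add: mult_le_0_iff)
  then show ?thesis
    using energy_zero_imp_zero[of w j] w0 supp by (cases "j \<le> J") auto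
qed

lemma level_solvable:
  assumes "1 \<le> m"
  shows "\<exists>w. w 0 = 0 \<and> (\<forall>j\<in>{1..J}. residual (V(m := w)) m j = f j)"
proof -
  define T where "T = (\<lambda>w. residual (\<lambda>k. if k = m then w else (\<lambda>_. 0)) m)"
  define r where "r = residual (V(m := \<lambda>_. 0)) m"
  have split: "residual (V(m := w)) m j = r j + T w j" for w j
  proof -
    have "V(m := w) = (\<lambda>k i. (V(m := \<lambda>_. 0)) k i + 1 * (if k = m then w else (\<lambda>_. 0)) i)"
      by (auto simp: fun_eq_iff)
    then show ?thesis
      using residual_linear[OF assms, of "V(m := \<lambda>_. 0)" 1 "\<lambda>k. if k = m then w else (\<lambda>_. 0)" j]
      by (simp add: r_def T_def)
  qed
  have "\<exists>w. (\<forall>j. j \<notin> {1..J} \<longrightarrow> w j = 0) \<and> (\<forall>j\<in>{1..J}. T w j = f j - r j)"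
  proof (rule definite_system_solvable)
    fix u v :: "nat \<Rightarrow> real" and a i
    have "(\<lambda>k. if k = m then (\<lambda>j. u j + a * v j) else (\<lambda>_. 0))
        = (\<lambda>k j. (if k = m then u else (\<lambda>_. 0)) j + a * (if k = m then v else (\<lambda>_. 0)) j)"
      by auto
    then show "T (\<lambda>j. u j + a * v j) i = T u i + a * T v i"
      unfolding T_def by (simp add: residual_linear[OF assms])
  next
    show "\<forall>j. w j = 0"
      if "\<forall>j. j \<notin> {1..J} \<longrightarrow> w j = 0" "(\<Sum>i\<in>{1..J}. w i * T w i) = 0" for w
      using residual_definite[OF assms that(1)] that(2) by (simp add: T_def)
  qed simp
  then obtain w where "\<forall>j. j \<notin> {1..J} \<longrightarrow> w j = 0" "\<forall>j\<in>{1..J}. T w j = f j - r j"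
    by blast
  then show ?thesis
    by (intro exI[of _ w]) (simp add: split)
qed

theorem solution_exists: "\<exists>U. solution F G Uh0 U"
proof -
  have "\<exists>U. U 0 = Uh0 \<and> (\<forall>m\<ge>1. U m 0 = 0 \<and> (\<forall>j\<in>{1..J}. residual U m j = load F G m j))"
  proof (rule causal_recursion)
    fix m :: nat and V :: "nat \<Rightarrow> nat \<Rightarrow> real"
    assume "1 \<le> m"
    then show "\<exists>w. (V(m := w)) m 0 = 0 \<and> (\<forall>j\<in>{1..J}. residual (V(m := w)) m j = load F G m j)"
      using level_solvable by simp
  next
    fix m :: nat and U V :: "nat \<Rightarrow> nat \<Rightarrow> real"
    assume "1 \<le> m" "\<forall>k\<le>m. U k = V k"
    then show "(U m 0 = 0 \<and> (\<forall>j\<in>{1..J}. residual U m j = load F G m j))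
        = (V m 0 = 0 \<and> (\<forall>j\<in>{1..J}. residual V m j = load F G m j))"
      using residual_causal[of m U V] by auto
  qed
  then show ?thesis
    unfolding solution_iff by auto
qed

theorem solution_unique:
  assumes "solution F G Uh0 U" "solution F G Uh0 V" "Uh0 0 = 0" "j \<le> J"
  shows "U m j = V m j"
proof -
  define D where "D = (\<lambda>k i. U k i + (- 1) * V k i)"
  have "residual D k i = 0" if "1 \<le> k" "i \<in> {1..J}" for k i
    using assms(1,2) that unfolding D_def residual_linear[OF that(1)] solution_iff by simp
  moreover have "load (\<lambda>_ _. 0) (\<lambda>_. 0) k i = 0" for k i
    by (simp add: load_def)
  ultimately have "solution (\<lambda>_ _. 0) (\<lambda>_. 0) (\<lambda>_. 0) D"
    using assms(1,2) unfolding solution_iff by (simp add: D_def)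
  then have "max (MAX k\<in>{0..m}. energy_norm (D k))
      (sqrt 2 * norm_two \<sigma> \<theta> x J rh bh ch (ch J) t m D) \<le> 0"
    using a_priori_bound[of "\<lambda>_ _. 0" "\<lambda>_. 0" "\<lambda>_. 0" D "\<lambda>_ _. 0" "\<lambda>_ _. 0" 0 m]
    by (simp add: dx_hat_def ip_omega_def ip_tilde_def norm_tilde_def norm_omega_time_def norm_omega_def
        norm_L_def L_form_eq ip_C_def dx_bar_def C_op_def s_minus_def Dt_bar_def dt_bar_def)
  moreover have "energy_norm (D m) \<le> (MAX k\<in>{0..m}. energy_norm (D k))"
    by (intro Max_ge) auto
  ultimately have "energy (D m) (D m) \<le> 0"
    by (simp add: norm_L_def)
  moreover have "D m 0 = 0"
    using assms(1-3) unfolding solution_iff by (cases "m = 0") (auto simp: D_def)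
  ultimately show ?thesis
    using energy_zero_imp_zero[of "D m" j] assms(4) by (simp add: D_def)
qed

end

section \<open>Stability and unique solvability of the scheme\<close>

theorem proposition2:
  fixes \<rho> b c :: "real \<Rightarrow> real"
    and \<rho>_low \<nu> \<rho>_inf b_inf c_inf X0 X \<sigma> \<theta> :: real
    and x t :: "nat \<Rightarrow> real" and J :: nat
    and S :: "nat \<Rightarrow> (nat \<Rightarrow> real) \<Rightarrow> real"
    and F :: "nat \<Rightarrow> nat \<Rightarrow> real" and G Uh0 :: "nat \<Rightarrow> real"
  defines "rh \<equiv> mesh_coeff x \<rho>" and "bh \<equiv> mesh_coeff x b" and "ch \<equiv> mesh_coeff x c"
  assumes "coefficients \<rho> b c \<rho>_low \<nu> \<rho>_inf b_inf c_inf X0"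
    and "X > X0"
    and "space_mesh x J X0 X"
    and "time_mesh t"
    and "Uh0 0 = 0" and "Uh0 J = 0"
    and "\<forall>m\<ge>1. linear_upto m (S m)"
    and "\<forall>\<Phi>. \<Phi> 0 = 0 \<longrightarrow> (\<forall>M\<ge>1. (\<Sum>m=1..M. S m \<Phi> * dt_bar t \<Phi> m * step t m) \<le> 0)"
    and "\<sigma> \<ge> 1/2"
  shows
    "(\<theta> < 1/4 \<longrightarrow>
       (\<forall>U F0 F1 M.
          scheme_solution \<sigma> \<theta> x J rh bh ch \<rho>_inf b_inf c_inf t S F G Uh0 U \<and>
          M \<ge> 1 \<and>
          (\<forall>m\<ge>1. \<forall>j\<in>{1..J - 1}. F m j = F0 m j + dx_hat x (F1 m) j) \<and>
          (\<forall>m. F1 m J = 0) \<longrightarrow>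
          max (MAX m\<in>{0..M}. norm_L \<theta> x J bh ch c_inf (U m))
              (sqrt 2 * norm_two \<sigma> \<theta> x J rh bh ch c_inf t M U)
          \<le> norm_L \<theta> x J bh ch c_inf Uh0
            + sqrt (2 / ((1 - 4 * max \<theta> 0) * \<rho>_low)) * norm_omega_time x J t M F0
            + 4 / sqrt \<nu> *
              (norm_tilde x J (F1 0) + (\<Sum>m=1..M. norm_tilde x J (Dt_bar t F1 m) * step t m)
               + sqrt X * (\<bar>G 0\<bar> + (\<Sum>m=1..M. \<bar>dt_bar t G m\<bar> * step t m)))))
     \<and>
     (\<theta> = 1/4 \<longrightarrow>
       (\<forall>U F1 M.
          scheme_solution \<sigma> \<theta> x J rh bh ch \<rho>_inf b_inf c_inf t S F G Uh0 U \<and>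
          M \<ge> 1 \<and>
          (\<forall>m\<ge>1. \<forall>j\<in>{1..J - 1}. F m j = dx_hat x (F1 m) j) \<and>
          (\<forall>m. F1 m J = 0) \<longrightarrow>
          max (MAX m\<in>{0..M}. norm_L \<theta> x J bh ch c_inf (U m))
              (sqrt 2 * norm_two \<sigma> \<theta> x J rh bh ch c_inf t M U)
          \<le> norm_L \<theta> x J bh ch c_inf Uh0
            + 4 / sqrt \<nu> *
              (norm_tilde x J (F1 0) + (\<Sum>m=1..M. norm_tilde x J (Dt_bar t F1 m) * step t m)
               + sqrt X * (\<bar>G 0\<bar> + (\<Sum>m=1..M. \<bar>dt_bar t G m\<bar> * step t m)))))
     \<and>
     (\<theta> \<le> 1/4 \<longrightarrow>
       (\<exists>U. scheme_solution \<sigma> \<theta> x J rh bh ch \<rho>_inf b_inf c_inf t S F G Uh0 U) \<and>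
       (\<forall>U V.
          scheme_solution \<sigma> \<theta> x J rh bh ch \<rho>_inf b_inf c_inf t S F G Uh0 U \<and>
          scheme_solution \<sigma> \<theta> x J rh bh ch \<rho>_inf b_inf c_inf t S F G Uh0 V \<longrightarrow>
          (\<forall>m. \<forall>j\<le>J. U m j = V m j)))"
proof -
  have data: "\<rho>_low > 0" "\<nu> > 0" "X0 > 0"
    and pos: "\<And>y. y > 0 \<Longrightarrow> \<rho>_low \<le> \<rho> y \<and> \<nu> \<le> b y \<and> 0 \<le> c y"
    and far: "\<And>y. y \<ge> X0 \<Longrightarrow> \<rho> y = \<rho>_inf \<and> b y = b_inf \<and> c y = c_inf"
    using assms(4) unfolding coefficients_def by blast+
  have mesh: "x 0 = 0" "strict_mono x" "x J = X" "step x J \<le> X - X0"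
    using assms(6) unfolding space_mesh_def by blast+
  have J: "1 \<le> J"
    using mesh(1,3) assms(5) data(3) by (cases "J = 0") auto
  have t: "strict_mono t"
    using assms(7) unfolding time_mesh_def by blast
  have mid_pos: "0 < mid x j" if "j \<in> {1..J}" for j
    using that mesh(1) strict_monoD[OF mesh(2), of 0 j] strict_mono_leD[OF mesh(2), of 0 "j - 1"]
    by (simp add: mid_def)
  (* the last cell lies beyond X0, where the coefficients are constant *)
  have "X0 \<le> mid x J"
    using mesh(3,4) assms(5) by (simp add: mid_def step_def)
  then have inf: "\<rho>_inf = rh J" "b_inf = bh J" "c_inf = ch J"
    using far by (simp_all add: assms(1-3) mesh_coeff_def)
  have scheme: "implicit_scheme x t J rh bh ch \<sigma> \<theta> \<rho>_low \<nu> S" if "\<theta> \<le> 1/4"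
    using mesh(1,2) J t data that assms(10-12) pos mid_pos
    by unfold_locales (auto simp: assms(1-3) mesh_coeff_def)
  show ?thesis
    unfolding inf mesh(3)[symmetric]
  proof (intro conjI impI allI)
    fix U F0 F1 :: "nat \<Rightarrow> nat \<Rightarrow> real" and M :: nat
    assume \<theta>: "\<theta> < 1/4"
      and H: "scheme_solution \<sigma> \<theta> x J rh bh ch (rh J) (bh J) (ch J) t S F G Uh0 U \<and> M \<ge> 1 \<and>
        (\<forall>m\<ge>1. \<forall>j\<in>{1..J - 1}. F m j = F0 m j + dx_hat x (F1 m) j) \<and> (\<forall>m. F1 m J = 0)"
    interpret implicit_scheme x t J rh bh ch \<sigma> \<theta> \<rho>_low \<nu> S
      using \<theta> by (intro scheme) linarith
    define k where "k = (1 - 4 * max \<theta> 0) * \<rho>_low"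
    have "0 < k" using \<theta> data(1) by (simp add: k_def)
    have "ip_omega x J (F0 m) W \<le> 1 / sqrt k * norm_omega x J (F0 m) * norm_C \<theta> x J rh W"
      if "W 0 = 0" for m W
    proof -
      have "0 \<le> hstep x j" if "j \<in> {1..J - 1}" for j
        using hstep_pos[OF mesh(2), of j] that by simp
      then have "ip_omega x J (F0 m) W \<le> norm_omega x J (F0 m) * norm_omega x J W"
        unfolding ip_omega_def norm_omega_def
        by (intro order_trans[OF abs_ge_self weighted_Cauchy_Schwarz])
      moreover have "sqrt k * norm_omega x J W \<le> norm_C \<theta> x J rh W"
        unfolding norm_omega_def norm_C_def real_sqrt_mult[symmetric] k_def
        using data(1) \<theta> that rh_ge
        by (intro real_sqrt_le_mono ip_C_coercive mesh(2) J) auto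
      then have "norm_omega x J W \<le> 1 / sqrt k * norm_C \<theta> x J rh W"
        using \<open>0 < k\<close> by (simp add: field_simps)
      moreover have "0 \<le> norm_omega x J (F0 m)"
        unfolding norm_omega_def ip_omega_def
        using hstep_pos[OF mesh(2)]
        by (intro real_sqrt_ge_zero sum_nonneg mult_nonneg_nonneg[OF zero_le_square])
          (simp add: less_imp_le)
      ultimately show ?thesis
        by (smt (verit) mult.assoc mult.commute mult_left_mono)
    qed
    moreover have "sqrt 2 * (1 / sqrt k) = sqrt (2 / k)"
      by (simp add: real_sqrt_divide)
    ultimately show "max (MAX m\<in>{0..M}. norm_L \<theta> x J bh ch (ch J) (U m))
              (sqrt 2 * norm_two \<sigma> \<theta> x J rh bh ch (ch J) t M U)
          \<le> norm_L \<theta> x J bh ch (ch J) Uh0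
            + sqrt (2 / ((1 - 4 * max \<theta> 0) * \<rho>_low)) * norm_omega_time x J t M F0
            + 4 / sqrt \<nu> *
              (norm_tilde x J (F1 0) + (\<Sum>m=1..M. norm_tilde x J (Dt_bar t F1 m) * step t m)
               + sqrt (x J) * (\<bar>G 0\<bar> + (\<Sum>m=1..M. \<bar>dt_bar t G m\<bar> * step t m)))"
      using a_priori_bound[of F G Uh0 U F0 F1 "1 / sqrt k" M] H assms(8,9) \<open>0 < k\<close>
      unfolding k_def[symmetric] by simp
  next
    fix U F1 :: "nat \<Rightarrow> nat \<Rightarrow> real" and M :: nat
    assume \<theta>: "\<theta> = 1/4"
      and H: "scheme_solution \<sigma> \<theta> x J rh bh ch (rh J) (bh J) (ch J) t S F G Uh0 U \<and> M \<ge> 1 \<and>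
        (\<forall>m\<ge>1. \<forall>j\<in>{1..J - 1}. F m j = dx_hat x (F1 m) j) \<and> (\<forall>m. F1 m J = 0)"
    interpret implicit_scheme x t J rh bh ch \<sigma> \<theta> \<rho>_low \<nu> S
      using \<theta> by (intro scheme) linarith
    show "max (MAX m\<in>{0..M}. norm_L \<theta> x J bh ch (ch J) (U m))
              (sqrt 2 * norm_two \<sigma> \<theta> x J rh bh ch (ch J) t M U)
          \<le> norm_L \<theta> x J bh ch (ch J) Uh0
            + 4 / sqrt \<nu> *
              (norm_tilde x J (F1 0) + (\<Sum>m=1..M. norm_tilde x J (Dt_bar t F1 m) * step t m)
               + sqrt (x J) * (\<bar>G 0\<bar> + (\<Sum>m=1..M. \<bar>dt_bar t G m\<bar> * step t m)))"
      using a_priori_bound[of F G Uh0 U "\<lambda>_ _. 0" F1 0 M] H assms(8,9)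
      by (simp add: ip_omega_def)
  next
    assume \<theta>: "\<theta> \<le> 1/4"
    interpret implicit_scheme x t J rh bh ch \<sigma> \<theta> \<rho>_low \<nu> S
      using \<theta> by (intro scheme) linarith
    show "\<exists>U. scheme_solution \<sigma> \<theta> x J rh bh ch (rh J) (bh J) (ch J) t S F G Uh0 U"
      by (rule solution_exists)
    show "U m j = V m j"
      if "scheme_solution \<sigma> \<theta> x J rh bh ch (rh J) (bh J) (ch J) t S F G Uh0 U \<and>
        scheme_solution \<sigma> \<theta> x J rh bh ch (rh J) (bh J) (ch J) t S F G Uh0 V" "j \<le> J" for U V m j
      using solution_unique that assms(8) by blast
  qed
qed

end
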